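(* Let $\Gamma$ be a countable discrete amenable group and $\sigma_i\colon\Gamma\to S_{d_i}$ a sofic approximation. Let $X$ be a compact metrizable space with $\Gamma\curvearrowright X$ by homeomorphisms, and let $k\in\mathbb{N}$. Then for any $1\le q\le\infty$, $$\mathrm{IE}^k_{(\sigma_i)_i}(q)=\mathrm{IE}^{\Lambda,k}_{(\sigma_i)_i}(q).$$
   Context: For $n\in\mathbb{N}$, $u_n$ is the uniform probability measure on $\{1,\dots,n\}$ and $S_n$ is the symmetric group. A sofic approximation of a countable discrete group $\Gamma$ is a sequence of functions (not assumed to be homomorphisms) $\sigma_i\colon\Gamma\to S_{d_i}$ such that $u_{d_i}(\{j:\sigma_i(gh)(j)=\sigma_i(g)\sigma_i(h)(j)\})\to 1$ for all $g,h\in\Gamma$ and $u_{d_i}(\{j:\sigma_i(g)(j)\ne j\})\to 1$ for all $g\in\Gamma\setminus\{e\}$. A continuous pseudometric $\rho$ on $X$ is dynamically generating if for all $x\ne y$ there is $g\in\Gamma$ with $\rho(gx,gy)>0$. For a finite set $A$ and $\phi,\psi\in X^A$, let $\rho_{q,A}(\phi,\psi)^q=\frac1{|A|}\sum_{a\in A}\rho(\phi(a),\psi(a))^q$ for $1\le q<\infty$ and $\rho_{\infty,A}(\phi,\psi)=\max_{a\in A}\rho(\phi(a),\psi(a))$ (interpreted as $0$ if $A=\varnothing$); $\rho_{q,d}$ means $\rho_{q,\{1,\dots,d\}}$. For finite $F\subseteq\Gamma$, $\delta>0$, $\mathrm{Map}(\rho,F,\delta,\sigma_i)$ is the set of $\phi\in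 X^{d_i}$ with $\max_{g\in F}\rho_{2,d_i}(\phi\circ\sigma_i(g),g\phi)<\delta$, where $(g\phi)(j)=g\phi(j)$. Let $x=(x_1,\dots,x_k)\in X^k$, $1\le q\le\infty$, $F,K\subseteq\Gamma$ finite, $\delta,\varepsilon>0$. A set $J\subseteq\{1,\dots,d_i\}$ is an $\ell^q$-$(\rho,F,\delta,\sigma_i;\varepsilon,K)$-independence set for $x$ if for every $c\colon J\to\{1,\dots,k\}$ there is $\phi\in\mathrm{Map}(\rho,F,\delta,\sigma_i)$ with $\max_{g\in K}\rho_{q,J}(g\phi(\cdot),gx_{c(\cdot)})<\varepsilon$. Let $I_q(x,\rho,F,\delta,\sigma_i;\varepsilon,K)$ be the maximum of $u_{d_i}(J)$ over such $J$ ($0$ if none), and $I_q(x,\rho,(\sigma_i)_i;\varepsilon,K)=\inf_{F,\delta}\limsup_i I_q(x,\rho,F,\delta,\sigma_i;\varepsilon,K)$. $\mathrm{IE}^k_{(\sigma_i)_i}(q)$ is the set of $x\in X^k$ with $I_q(x,\rho,(\sigma_i)_i;\varepsilon,K)>0$ for all $\varepsilon>0$ and finite $K\subseteq\Gamma$; it does not depend on the continuous dynamically generating pseudometric $\rho$. Write elements of $\mathbb{C}(\Gamma)$ as $\alpha=\sum_g\widehat\alpha(g)g$ and let $\lambda$ be the left regular representation of $\mathbb{C}(\Gamma)$ on $\ell^2(\Gamma)$. Let $\sigma_i(\alpha)=\sum_g\widehat\alpha(g)\sigma_i(g)\in M_{d_i}(\mathbb{C})$, with $\sigma_i(g)$ viewed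 as a permutation matrix, $(\sigma_i(g)\xi)(j)=\xi(\sigma_i(g)^{-1}(j))$. $\|\cdot\|_2$ on $\mathbb{C}^{d_i}$ is the norm of $\ell^2(d_i,u_{d_i})$. For finite $E\subseteq\mathbb{C}(\Gamma)$, $\eta>0$, $\Lambda(E,\eta,\sigma_i)$ is the set of $J\subseteq\{1,\dots,d_i\}$ with $\|\sigma_i(\alpha)(\chi_J-u_{d_i}(J)1)\|_2\le\|\lambda(\alpha)\|\,\|\chi_J-u_{d_i}(J)1\|_2+\eta$ for all $\alpha\in E$ ($\|\lambda(\alpha)\|$ the operator norm). $\Lambda_{(\sigma_i)_i}$ is the set of sequences $(J_i)_i$, $J_i\subseteq\{1,\dots,d_i\}$, such that for all finite $E\subseteq\mathbb{C}(\Gamma)$ and $\eta>0$, $J_i\in\Lambda(E,\eta,\sigma_i)$ for all large $i$. For $E\subseteq\mathbb{C}(\Gamma)$ finite and $\eta>0$, a $\Lambda$-$\ell^q$-$(\rho,F,\delta,E,\eta;\varepsilon,K)$-independence sequence for $x$ is a sequence $(J_i)_i\in\Lambda_{(\sigma_i)_i}$ such that for all sufficiently large $i$ and every $c\colon J_i\to\{1,\dots,k\}$ with $c^{-1}(\{l\})\in\Lambda(E,\eta,\sigma_i)$ for $1\le l\le k$ there is $\phi\in\mathrm{Map}(\rho,F,\delta,\sigma_i)$ with $\max_{g\in K}\rho_{q,J_i}(g\phi(\cdot),gx_{c(\cdot)})<\varepsilon$. Let $I_{\Lambda,q}(x,\rho,F,\delta,E,\eta,(\sigma_i)_i;\varepsilon,K)$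 be the supremum of $\limsup_i u_{d_i}(J_i)$ over such sequences ($0$ if none), and $I_{\Lambda,q}(x,\rho,(\sigma_i)_i;\varepsilon,K)=\inf_{F,\delta}\sup_{E,\eta}I_{\Lambda,q}(x,\rho,F,\delta,E,\eta,(\sigma_i)_i;\varepsilon,K)$. $\mathrm{IE}^{\Lambda,k}_{(\sigma_i)_i}(q)$ is the set of $x\in X^k$ with $I_{\Lambda,q}(x,\rho,(\sigma_i)_i;\varepsilon,K)>0$ for all $\varepsilon>0$ and finite $K\subseteq\Gamma$ ($\ell^q$-independence tuples satisfying the weak containment condition); it does not depend on $\rho$. *)

theory Defs
  imports
    "HOL-Algebra.Group_Action"
    "HOL-Analysis.Analysis"
    "HOL-Library.Poly_Mapping"
begin

section \<open>Amenable groups and sofic approximations\<close>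

text \<open>Amenability is taken to mean the Foelner condition.\<close>

definition amenable :: "('g, 'b) monoid_scheme \<Rightarrow> bool" where
  "amenable \<Gamma> \<longleftrightarrow> group \<Gamma> \<and>
    (\<forall>K \<epsilon>. finite K \<and> K \<subseteq> carrier \<Gamma> \<and> \<epsilon> > (0::real) \<longrightarrow>
      (\<exists>F. finite F \<and> F \<noteq> {} \<and> F \<subseteq> carrier \<Gamma> \<and>
        (\<forall>g\<in>K. real (card (sym_diff (g <#\<^bsub>\<Gamma>\<^esub> F) F)) \<le> \<epsilon> * real (card F))))"

definition unif :: "nat \<Rightarrow> nat set \<Rightarrow> real" where
  "unif n J = real (card (J \<inter> {1..n})) / real n"

text \<open>An element of the symmetric group on \<open>{1..n}\<close> is a function that permutes \<open>{1..n}\<close>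
  (and is the identity elsewhere).\<close>

definition sofic_approximation ::
  "('g, 'b) monoid_scheme \<Rightarrow> (nat \<Rightarrow> nat) \<Rightarrow> (nat \<Rightarrow> 'g \<Rightarrow> nat \<Rightarrow> nat) \<Rightarrow> bool" where
  "sofic_approximation \<Gamma> d \<sigma> \<longleftrightarrow>
    (\<forall>i. d i \<ge> 1) \<and>
    (\<forall>i. \<forall>g\<in>carrier \<Gamma>. \<sigma> i g permutes {1..d i}) \<and>
    (\<forall>g\<in>carrier \<Gamma>. \<forall>h\<in>carrier \<Gamma>.
      (\<lambda>i. unif (d i) {j\<in>{1..d i}. \<sigma> i (g \<otimes>\<^bsub>\<Gamma>\<^esub> h) j = \<sigma> i g (\<sigma> i h j)}) \<longlonglongrightarrow> 1) \<and>
    (\<forall>g\<in>carrier \<Gamma> - {\<one>\<^bsub>\<Gamma>\<^esub>}.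
      (\<lambda>i. unif (d i) {j\<in>{1..d i}. \<sigma> i g j \<noteq> j}) \<longlonglongrightarrow> 1)"


section \<open>Actions and dynamically generating pseudometrics\<close>

definition acts_by_homeomorphisms ::
  "('g, 'b) monoid_scheme \<Rightarrow> 'x topology \<Rightarrow> ('g \<Rightarrow> 'x \<Rightarrow> 'x) \<Rightarrow> bool" where
  "acts_by_homeomorphisms \<Gamma> X act \<longleftrightarrow>
    group_action \<Gamma> (topspace X) act \<and> (\<forall>g\<in>carrier \<Gamma>. homeomorphic_map X X (act g))"

definition continuous_pseudometric :: "'x topology \<Rightarrow> ('x \<Rightarrow> 'x \<Rightarrow> real) \<Rightarrow> bool" where
  "continuous_pseudometric X \<rho> \<longleftrightarrow>
    (\<forall>x\<in>topspace X. \<forall>y\<in>topspace X. \<rho> x y \<ge> 0) \<and>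
    (\<forall>x\<in>topspace X. \<rho> x x = 0) \<and>
    (\<forall>x\<in>topspace X. \<forall>y\<in>topspace X. \<rho> x y = \<rho> y x) \<and>
    (\<forall>x\<in>topspace X. \<forall>y\<in>topspace X. \<forall>z\<in>topspace X. \<rho> x z \<le> \<rho> x y + \<rho> y z) \<and>
    continuous_map (prod_topology X X) euclideanreal (\<lambda>(x, y). \<rho> x y)"

definition dynamically_generating ::
  "('g, 'b) monoid_scheme \<Rightarrow> 'x topology \<Rightarrow> ('g \<Rightarrow> 'x \<Rightarrow> 'x) \<Rightarrow> ('x \<Rightarrow> 'x \<Rightarrow> real) \<Rightarrow> bool" where
  "dynamically_generating \<Gamma> X act \<rho> \<longleftrightarrow>
    (\<forall>x\<in>topspace X. \<forall>y\<in>topspace X. x \<noteq> y \<longrightarrow> (\<exists>g\<in>carrier \<Gamma>. \<rho> (act g x) (act g y) > 0))"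

definition lq_dist ::
  "('x \<Rightarrow> 'x \<Rightarrow> real) \<Rightarrow> ereal \<Rightarrow> 'a set \<Rightarrow> ('a \<Rightarrow> 'x) \<Rightarrow> ('a \<Rightarrow> 'x) \<Rightarrow> real" where
  "lq_dist \<rho> q A \<phi> \<psi> =
    (if A = {} then 0
     else if q = \<infinity> then Max ((\<lambda>a. \<rho> (\<phi> a) (\<psi> a)) ` A)
     else ((\<Sum>a\<in>A. \<rho> (\<phi> a) (\<psi> a) powr real_of_ereal q) / real (card A))
            powr (1 / real_of_ereal q))"

text \<open>The following concern a single map \<open>s\<close> from the group to the permutations of
  \<open>{1..n}\<close>; they are used with \<open>n = d i\<close> and \<open>s = \<sigma> i\<close>.\<close>

definition Map_approx ::
  "'x topology \<Rightarrow> ('g \<Rightarrow> 'x \<Rightarrow> 'x) \<Rightarrow> ('x \<Rightarrow> 'x \<Rightarrow> real) \<Rightarrow> 'g set \<Rightarrow> real \<Rightarrow>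
    nat \<Rightarrow> ('g \<Rightarrow> nat \<Rightarrow> nat) \<Rightarrow> (nat \<Rightarrow> 'x) set" where
  "Map_approx X act \<rho> F \<delta> n s =
    {\<phi> \<in> {1..n} \<rightarrow>\<^sub>E topspace X.
      \<forall>g\<in>F. lq_dist \<rho> 2 {1..n} (\<phi> \<circ> s g) (\<lambda>j. act g (\<phi> j)) < \<delta>}"


section \<open>Independence tuples\<close>

definition shadows ::
  "'x topology \<Rightarrow> ('g \<Rightarrow> 'x \<Rightarrow> 'x) \<Rightarrow> ('x \<Rightarrow> 'x \<Rightarrow> real) \<Rightarrow> ereal \<Rightarrow> (nat \<Rightarrow> 'x) \<Rightarrow>
    'g set \<Rightarrow> real \<Rightarrow> nat \<Rightarrow> ('g \<Rightarrow> nat \<Rightarrow> nat) \<Rightarrow> real \<Rightarrow> 'g set \<Rightarrow>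
    nat set \<Rightarrow> (nat \<Rightarrow> nat) \<Rightarrow> bool" where
  "shadows X act \<rho> q x F \<delta> n s \<epsilon> K J c \<longleftrightarrow>
    (\<exists>\<phi>\<in>Map_approx X act \<rho> F \<delta> n s.
      \<forall>g\<in>K. lq_dist \<rho> q J (\<lambda>j. act g (\<phi> j)) (\<lambda>j. act g (x (c j))) < \<epsilon>)"

definition independence_set ::
  "'x topology \<Rightarrow> ('g \<Rightarrow> 'x \<Rightarrow> 'x) \<Rightarrow> ('x \<Rightarrow> 'x \<Rightarrow> real) \<Rightarrow> ereal \<Rightarrow> nat \<Rightarrow> (nat \<Rightarrow> 'x) \<Rightarrow>
    'g set \<Rightarrow> real \<Rightarrow> nat \<Rightarrow> ('g \<Rightarrow> nat \<Rightarrow> nat) \<Rightarrow> real \<Rightarrow> 'g set \<Rightarrow> nat set \<Rightarrow> bool" where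
  "independence_set X act \<rho> q k x F \<delta> n s \<epsilon> K J \<longleftrightarrow>
    J \<subseteq> {1..n} \<and> (\<forall>c\<in>J \<rightarrow>\<^sub>E {1..k}. shadows X act \<rho> q x F \<delta> n s \<epsilon> K J c)"

definition indep_density_at ::
  "'x topology \<Rightarrow> ('g \<Rightarrow> 'x \<Rightarrow> 'x) \<Rightarrow> ('x \<Rightarrow> 'x \<Rightarrow> real) \<Rightarrow> ereal \<Rightarrow> nat \<Rightarrow> (nat \<Rightarrow> 'x) \<Rightarrow>
    'g set \<Rightarrow> real \<Rightarrow> nat \<Rightarrow> ('g \<Rightarrow> nat \<Rightarrow> nat) \<Rightarrow> real \<Rightarrow> 'g set \<Rightarrow> real" where
  "indep_density_at X act \<rho> q k x F \<delta> n s \<epsilon> K =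
    Max (insert 0 (unif n ` {J. independence_set X act \<rho> q k x F \<delta> n s \<epsilon> K J}))"

definition indep_density ::
  "('g, 'b) monoid_scheme \<Rightarrow> 'x topology \<Rightarrow> ('g \<Rightarrow> 'x \<Rightarrow> 'x) \<Rightarrow> ('x \<Rightarrow> 'x \<Rightarrow> real) \<Rightarrow>
    (nat \<Rightarrow> nat) \<Rightarrow> (nat \<Rightarrow> 'g \<Rightarrow> nat \<Rightarrow> nat) \<Rightarrow> ereal \<Rightarrow> nat \<Rightarrow> (nat \<Rightarrow> 'x) \<Rightarrow>
    real \<Rightarrow> 'g set \<Rightarrow> ereal" where
  "indep_density \<Gamma> X act \<rho> d \<sigma> q k x \<epsilon> K =
    (INF F\<in>{F. finite F \<and> F \<subseteq> carrier \<Gamma>}. INF \<delta>\<in>{0<..}.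
      limsup (\<lambda>i. ereal (indep_density_at X act \<rho> q k x F \<delta> (d i) (\<sigma> i) \<epsilon> K)))"

definition IE ::
  "('g, 'b) monoid_scheme \<Rightarrow> 'x topology \<Rightarrow> ('g \<Rightarrow> 'x \<Rightarrow> 'x) \<Rightarrow> ('x \<Rightarrow> 'x \<Rightarrow> real) \<Rightarrow>
    (nat \<Rightarrow> nat) \<Rightarrow> (nat \<Rightarrow> 'g \<Rightarrow> nat \<Rightarrow> nat) \<Rightarrow> nat \<Rightarrow> ereal \<Rightarrow> (nat \<Rightarrow> 'x) set" where
  "IE \<Gamma> X act \<rho> d \<sigma> k q =
    {x \<in> {1..k} \<rightarrow>\<^sub>E topspace X.
      \<forall>\<epsilon> K. \<epsilon> > 0 \<and> finite K \<and> K \<subseteq> carrier \<Gamma> \<longrightarrow> indep_density \<Gamma> X act \<rho> d \<sigma> q k x \<epsilon> K > 0}"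


section \<open>The weak containment condition\<close>

definition group_algebra :: "('g, 'b) monoid_scheme \<Rightarrow> ('g \<Rightarrow>\<^sub>0 complex) set" where
  "group_algebra \<Gamma> = {\<alpha>. Poly_Mapping.keys \<alpha> \<subseteq> carrier \<Gamma>}"

text \<open>Vectors of \<open>\<ell>\<^sup>2(\<Gamma>)\<close> are represented by functions whose values off \<open>carrier \<Gamma>\<close> are ignored.\<close>

definition l2_vector :: "('g, 'b) monoid_scheme \<Rightarrow> ('g \<Rightarrow> complex) \<Rightarrow> bool" where
  "l2_vector \<Gamma> \<xi> \<longleftrightarrow> (\<lambda>g. (cmod (\<xi> g))\<^sup>2) summable_on carrier \<Gamma>"

definition l2_norm :: "('g, 'b) monoid_scheme \<Rightarrow> ('g \<Rightarrow> complex) \<Rightarrow> real" where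
  "l2_norm \<Gamma> \<xi> = sqrt (infsum (\<lambda>g. (cmod (\<xi> g))\<^sup>2) (carrier \<Gamma>))"

definition left_regular ::
  "('g, 'b) monoid_scheme \<Rightarrow> ('g \<Rightarrow>\<^sub>0 complex) \<Rightarrow> ('g \<Rightarrow> complex) \<Rightarrow> 'g \<Rightarrow> complex" where
  "left_regular \<Gamma> \<alpha> \<xi> h =
    (\<Sum>g\<in>Poly_Mapping.keys \<alpha>. Poly_Mapping.lookup \<alpha> g * \<xi> (inv\<^bsub>\<Gamma>\<^esub> g \<otimes>\<^bsub>\<Gamma>\<^esub> h))"

definition left_regular_opnorm :: "('g, 'b) monoid_scheme \<Rightarrow> ('g \<Rightarrow>\<^sub>0 complex) \<Rightarrow> real" where
  "left_regular_opnorm \<Gamma> \<alpha> =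
    Sup {l2_norm \<Gamma> (left_regular \<Gamma> \<alpha> \<xi>) | \<xi>. l2_vector \<Gamma> \<xi> \<and> l2_norm \<Gamma> \<xi> \<le> 1}"

text \<open>\<open>perm_rep n s \<alpha>\<close> is the operator on functions on \<open>{1..n}\<close> given by the matrix
  \<open>\<Sum>\<^sub>g \<alpha>(g) s(g)\<close>, with \<open>s(g)\<close> viewed as a permutation matrix.\<close>

definition perm_rep ::
  "nat \<Rightarrow> ('g \<Rightarrow> nat \<Rightarrow> nat) \<Rightarrow> ('g \<Rightarrow>\<^sub>0 complex) \<Rightarrow> (nat \<Rightarrow> complex) \<Rightarrow> nat \<Rightarrow> complex" where
  "perm_rep n s \<alpha> \<xi> j =
    (\<Sum>g\<in>Poly_Mapping.keys \<alpha>. Poly_Mapping.lookup \<alpha> g * \<xi> (inv_into {1..n} (s g) j))"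

definition unif_norm2 :: "nat \<Rightarrow> (nat \<Rightarrow> complex) \<Rightarrow> real" where
  "unif_norm2 n \<xi> = sqrt ((\<Sum>j\<in>{1..n}. (cmod (\<xi> j))\<^sup>2) / real n)"

definition centered_indicator :: "nat \<Rightarrow> nat set \<Rightarrow> nat \<Rightarrow> complex" where
  "centered_indicator n J j = indicator J j - complex_of_real (unif n J)"

definition Lambda_at ::
  "('g, 'b) monoid_scheme \<Rightarrow> ('g \<Rightarrow>\<^sub>0 complex) set \<Rightarrow> real \<Rightarrow> nat \<Rightarrow> ('g \<Rightarrow> nat \<Rightarrow> nat) \<Rightarrow>
    nat set set" where
  "Lambda_at \<Gamma> E \<eta> n s =
    {J. J \<subseteq> {1..n} \<and>
      (\<forall>\<alpha>\<in>E. unif_norm2 n (perm_rep n s \<alpha> (centered_indicator n J))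
        \<le> left_regular_opnorm \<Gamma> \<alpha> * unif_norm2 n (centered_indicator n J) + \<eta>)}"

definition Lambda_seq ::
  "('g, 'b) monoid_scheme \<Rightarrow> (nat \<Rightarrow> nat) \<Rightarrow> (nat \<Rightarrow> 'g \<Rightarrow> nat \<Rightarrow> nat) \<Rightarrow> (nat \<Rightarrow> nat set) set" where
  "Lambda_seq \<Gamma> d \<sigma> =
    {J. (\<forall>i. J i \<subseteq> {1..d i}) \<and>
      (\<forall>E \<eta>. finite E \<and> E \<subseteq> group_algebra \<Gamma> \<and> \<eta> > 0 \<longrightarrow>
        (\<forall>\<^sub>F i in sequentially. J i \<in> Lambda_at \<Gamma> E \<eta> (d i) (\<sigma> i)))}"

definition Lambda_independence_sequence ::
  "('g, 'b) monoid_scheme \<Rightarrow> 'x topology \<Rightarrow> ('g \<Rightarrow> 'x \<Rightarrow> 'x) \<Rightarrow> ('x \<Rightarrow> 'x \<Rightarrow> real) \<Rightarrow>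
    (nat \<Rightarrow> nat) \<Rightarrow> (nat \<Rightarrow> 'g \<Rightarrow> nat \<Rightarrow> nat) \<Rightarrow> ereal \<Rightarrow> nat \<Rightarrow> (nat \<Rightarrow> 'x) \<Rightarrow>
    'g set \<Rightarrow> real \<Rightarrow> ('g \<Rightarrow>\<^sub>0 complex) set \<Rightarrow> real \<Rightarrow> real \<Rightarrow> 'g set \<Rightarrow>
    (nat \<Rightarrow> nat set) \<Rightarrow> bool" where
  "Lambda_independence_sequence \<Gamma> X act \<rho> d \<sigma> q k x F \<delta> E \<eta> \<epsilon> K J \<longleftrightarrow>
    J \<in> Lambda_seq \<Gamma> d \<sigma> \<and>
    (\<forall>\<^sub>F i in sequentially. \<forall>c\<in>J i \<rightarrow>\<^sub>E {1..k}.
      (\<forall>l\<in>{1..k}. {j\<in>J i. c j = l} \<in> Lambda_at \<Gamma> E \<eta> (d i) (\<sigma> i)) \<longrightarrow>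
      shadows X act \<rho> q x F \<delta> (d i) (\<sigma> i) \<epsilon> K (J i) c)"

definition Lambda_indep_density_at ::
  "('g, 'b) monoid_scheme \<Rightarrow> 'x topology \<Rightarrow> ('g \<Rightarrow> 'x \<Rightarrow> 'x) \<Rightarrow> ('x \<Rightarrow> 'x \<Rightarrow> real) \<Rightarrow>
    (nat \<Rightarrow> nat) \<Rightarrow> (nat \<Rightarrow> 'g \<Rightarrow> nat \<Rightarrow> nat) \<Rightarrow> ereal \<Rightarrow> nat \<Rightarrow> (nat \<Rightarrow> 'x) \<Rightarrow>
    'g set \<Rightarrow> real \<Rightarrow> ('g \<Rightarrow>\<^sub>0 complex) set \<Rightarrow> real \<Rightarrow> real \<Rightarrow> 'g set \<Rightarrow> ereal" where
  "Lambda_indep_density_at \<Gamma> X act \<rho> d \<sigma> q k x F \<delta> E \<eta> \<epsilon> K =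
    Sup (insert 0
      {limsup (\<lambda>i. ereal (unif (d i) (J i))) | J.
        Lambda_independence_sequence \<Gamma> X act \<rho> d \<sigma> q k x F \<delta> E \<eta> \<epsilon> K J})"

definition Lambda_indep_density ::
  "('g, 'b) monoid_scheme \<Rightarrow> 'x topology \<Rightarrow> ('g \<Rightarrow> 'x \<Rightarrow> 'x) \<Rightarrow> ('x \<Rightarrow> 'x \<Rightarrow> real) \<Rightarrow>
    (nat \<Rightarrow> nat) \<Rightarrow> (nat \<Rightarrow> 'g \<Rightarrow> nat \<Rightarrow> nat) \<Rightarrow> ereal \<Rightarrow> nat \<Rightarrow> (nat \<Rightarrow> 'x) \<Rightarrow>
    real \<Rightarrow> 'g set \<Rightarrow> ereal" where
  "Lambda_indep_density \<Gamma> X act \<rho> d \<sigma> q k x \<epsilon> K =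
    (INF F\<in>{F. finite F \<and> F \<subseteq> carrier \<Gamma>}. INF \<delta>\<in>{0<..}.
      SUP E\<in>{E. finite E \<and> E \<subseteq> group_algebra \<Gamma>}. SUP \<eta>\<in>{0<..}.
        Lambda_indep_density_at \<Gamma> X act \<rho> d \<sigma> q k x F \<delta> E \<eta> \<epsilon> K)"

definition IE_Lambda ::
  "('g, 'b) monoid_scheme \<Rightarrow> 'x topology \<Rightarrow> ('g \<Rightarrow> 'x \<Rightarrow> 'x) \<Rightarrow> ('x \<Rightarrow> 'x \<Rightarrow> real) \<Rightarrow>
    (nat \<Rightarrow> nat) \<Rightarrow> (nat \<Rightarrow> 'g \<Rightarrow> nat \<Rightarrow> nat) \<Rightarrow> nat \<Rightarrow> ereal \<Rightarrow> (nat \<Rightarrow> 'x) set" where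
  "IE_Lambda \<Gamma> X act \<rho> d \<sigma> k q =
    {x \<in> {1..k} \<rightarrow>\<^sub>E topspace X.
      \<forall>\<epsilon> K. \<epsilon> > 0 \<and> finite K \<and> K \<subseteq> carrier \<Gamma> \<longrightarrow>
        Lambda_indep_density \<Gamma> X act \<rho> d \<sigma> q k x \<epsilon> K > 0}"

end

theory Submission
  imports Defs "HOL-Combinatorics.Permutations"
begin

text \<open>Amenability makes the weak containment condition vacuous: averaging the regular
  representation over a Foelner set shows that \<open>\<parallel>\<sigma>\<^sub>i(\<alpha>) \<xi>\<parallel>\<^sub>2 \<le> \<parallel>\<lambda>(\<alpha>)\<parallel> \<parallel>\<xi>\<parallel>\<^sub>2 + \<eta>\<close> for all large \<open>i\<close>,
  uniformly in \<open>\<xi>\<close> bounded by \<open>1\<close>, so eventually every subset of \<open>{1..d i}\<close> is in \<open>Lambda_at\<close>.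
  An independence sequence is then a choice of independence sets for all large \<open>i\<close>, whose supremal
  density is the limsup of the maximal densities provided that independence sets exist for all
  large \<open>i\<close>. This holds for \<open>{}\<close> as soon as \<open>Map_approx\<close> is nonempty: an approximately equivariant
  map \<open>j \<mapsto> (a j)\<^sup>-\<^sup>1 x\<^sub>0\<close> arises from a selection \<open>a\<close> of group elements with \<open>a (\<sigma> g j) g = a j\<close> for
  most \<open>j\<close>.\<close>

section \<open>Almost equivariant selections\<close>

text \<open>Read \<pi> as a random ordering of \<open>W\<close>. Composing with the transposition of
  \<open>u\<close> and \<open>w\<close> carries orderings that put \<open>u\<close> first in
  \<open>U\<close> to those that put \<open>w\<close> first, so all points of \<open>U\<close> are
  equally likely to come first. Hence the first one misses \<open>V\<close> with probability at most
  \<open>card (U - V) / card U\<close>.\<close>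

lemma card_permutations_argmin_outside_le:
  fixes U V W :: "nat set"
  assumes W: "finite W" and U: "U \<subseteq> W" and V: "V \<subseteq> U"
  shows "card U * card {\<pi>. \<pi> permutes W \<and> (\<exists>u\<in>U - V. \<forall>v\<in>U. \<pi> u \<le> \<pi> v)}
    \<le> card (U - V) * card {\<pi>. \<pi> permutes W}"
proof (cases "U = {}")
  case False
  then obtain u0 where u0: "u0 \<in> U" by blast
  define A where "A u = {\<pi>. \<pi> permutes W \<and> (\<forall>v\<in>U. \<pi> u \<le> \<pi> v)}" for u
  have finU: "finite U" using W U finite_subset by blast
  have finP: "finite {\<pi>. \<pi> permutes W}" using W by (rule finite_permutations)
  have finA: "finite (A u)" for u
    by (rule finite_subset[OF _ finP]) (auto simp: A_def)
  have le: "card (A u) \<le> card (A w)" if u: "u \<in> U" and w: "w \<in> U" for u w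
  proof (rule card_inj_on_le[where f = "\<lambda>\<pi>. \<pi> \<circ> Transposition.transpose u w"])
    show "inj_on (\<lambda>\<pi>. \<pi> \<circ> Transposition.transpose u w) (A u)"
      by (rule inj_on_inverseI[where g = "\<lambda>\<pi>. \<pi> \<circ> Transposition.transpose u w"]) (simp add: comp_assoc)
    show "(\<lambda>\<pi>. \<pi> \<circ> Transposition.transpose u w) ` A u \<subseteq> A w"
    proof clarify
      fix \<pi> assume \<pi>: "\<pi> \<in> A u"
      have "Transposition.transpose u w permutes W"
        using u w U by (intro permutes_swap_id) auto
      moreover have "\<pi> permutes W" using \<pi> by (simp add: A_def)
      ultimately have "\<pi> \<circ> Transposition.transpose u w permutes W" by (intro permutes_compose)
      moreover have "\<pi> u \<le> \<pi> (Transposition.transpose u w v)" if "v \<in> U" for v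
        using \<pi> that u w by (auto simp: A_def Transposition.transpose_def)
      ultimately show "\<pi> \<circ> Transposition.transpose u w \<in> A w" by (auto simp: A_def)
    qed
  qed (rule finA)
  have eq: "card (A u) = card (A u0)" if "u \<in> U" for u
    using le[OF that u0] le[OF u0 that] by simp
  \<comment> \<open>Two distinct points of \<open>U\<close> cannot both come first, as \<pi> is
    injective. The classes \<open>A u\<close> thus have equal size and are disjoint, so each is at
    most a \<open>card U\<close>-th part of all orderings.\<close>
  have disj: "A u \<inter> A v = {}" if "u \<in> U" "v \<in> U" "u \<noteq> v" for u v
  proof -
    have "u = v" if "\<pi> \<in> A u" "\<pi> \<in> A v" for \<pi>
    proof -
      have "\<pi> u = \<pi> v" using that \<open>u \<in> U\<close> \<open>v \<in> U\<close> by (auto simp: A_def intro!: antisym)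
      moreover have "inj \<pi>" using that by (auto simp: A_def intro: permutes_inj)
      ultimately show ?thesis by (simp add: inj_eq)
    qed
    then show ?thesis using \<open>u \<noteq> v\<close> by blast
  qed
  have "card U * card (A u0) = (\<Sum>u\<in>U. card (A u))" using eq by simp
  also have "\<dots> = card (\<Union>u\<in>U. A u)"
    using finU finA disj by (subst card_UN_disjoint) auto
  also have "\<dots> \<le> card {\<pi>. \<pi> permutes W}"
    by (rule card_mono[OF finP]) (auto simp: A_def)
  finally have 1: "card U * card (A u0) \<le> card {\<pi>. \<pi> permutes W}" .
  have "card {\<pi>. \<pi> permutes W \<and> (\<exists>u\<in>U - V. \<forall>v\<in>U. \<pi> u \<le> \<pi> v)} = card (\<Union>u\<in>U - V. A u)"
    by (rule arg_cong[where f = card]) (auto simp: A_def)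
  also have "\<dots> \<le> (\<Sum>u\<in>U - V. card (A u))"
    using finU by (intro card_UN_le) auto
  also have "\<dots> = card (U - V) * card (A u0)" using eq by simp
  finally have "card U * card {\<pi>. \<pi> permutes W \<and> (\<exists>u\<in>U - V. \<forall>v\<in>U. \<pi> u \<le> \<pi> v)}
      \<le> card (U - V) * (card U * card (A u0))"
    by (subst mult.left_commute) (rule mult_le_mono2)
  also have "\<dots> \<le> card (U - V) * card {\<pi>. \<pi> permutes W}" using 1 by simp
  finally show ?thesis .
qed simp

lemma exists_le_average:
  fixes f :: "'a \<Rightarrow> real"
  assumes "finite P" "P \<noteq> {}" "(\<Sum>p\<in>P. f p) \<le> C * real (card P)"
  shows "\<exists>p\<in>P. f p \<le> C"
proof (rule ccontr)
  assume "\<not> ?thesis"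
  then have "(\<Sum>p\<in>P. C) < (\<Sum>p\<in>P. f p)"
    using assms by (intro sum_strict_mono) (auto simp: not_le)
  then show False using assms by (simp add: mult.commute)
qed

lemma sum_card_filter_swap:
  assumes "finite A" "finite B"
  shows "(\<Sum>a\<in>A. card {b\<in>B. R a b}) = (\<Sum>b\<in>B. card {a\<in>A. R a b})"
proof -
  have "(\<Sum>a\<in>A. card {b\<in>B. R a b}) = (\<Sum>a\<in>A. \<Sum>b\<in>B. if R a b then 1 else 0)"
    using assms by (simp add: sum.If_cases Int_def conj_commute)
  also have "\<dots> = (\<Sum>b\<in>B. \<Sum>a\<in>A. if R a b then 1 else 0)" by (rule sum.swap)
  also have "\<dots> = (\<Sum>b\<in>B. card {a\<in>A. R a b})"
    using assms by (simp add: sum.If_cases Int_def conj_commute)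
  finally show ?thesis .
qed

text \<open>Each \<open>j\<close> selects the \<open>a \<in> S\<close> for which \<open>s a j\<close> comes first in a random order of
  \<open>{1..n}\<close>. If the first element of \<open>s (S \<union> S g) j\<close> lies in \<open>s (S \<inter> S g) j\<close>, then \<open>j\<close> and
  \<open>s g j\<close> select the same point, and for right Foelner \<open>S\<close> this fails with small probability.\<close>

lemma exists_almost_equivariant_selection:
  fixes \<Gamma> :: "('g, 'b) monoid_scheme" and s :: "'g \<Rightarrow> nat \<Rightarrow> nat"
  assumes "group \<Gamma>"
    and S: "finite S" "S \<noteq> {}" "S \<subseteq> carrier \<Gamma>"
    and K: "finite K" "K \<subseteq> carrier \<Gamma>"
    and s: "\<And>g. g \<in> carrier \<Gamma> \<Longrightarrow> s g permutes {1..n}"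
    and foelner: "\<And>g. g \<in> K \<Longrightarrow>
      real (card (sym_diff S ((\<lambda>a. a \<otimes>\<^bsub>\<Gamma>\<^esub> g) ` S))) \<le> e * real (card S)"
    and G: "G \<subseteq> {1..n}"
    and inj: "\<And>j g. j \<in> G \<Longrightarrow> g \<in> K \<Longrightarrow> inj_on (\<lambda>a. s a j) (S \<union> (\<lambda>a. a \<otimes>\<^bsub>\<Gamma>\<^esub> g) ` S)"
    and mult: "\<And>j g a. j \<in> G \<Longrightarrow> g \<in> K \<Longrightarrow> a \<in> S \<Longrightarrow> s a (s g j) = s (a \<otimes>\<^bsub>\<Gamma>\<^esub> g) j"
  shows "\<exists>a :: nat \<Rightarrow> 'g. (\<forall>j. a j \<in> S) \<and>
    (\<forall>g\<in>K. real (card {j\<in>{1..n}. a (s g j) \<otimes>\<^bsub>\<Gamma>\<^esub> g \<noteq> a j})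
      \<le> e * real (card K) * real n + real (card ({1..n} - G)))"
proof -
  interpret group \<Gamma> by fact
  define R where "R g = (\<lambda>a. a \<otimes>\<^bsub>\<Gamma>\<^esub> g) ` S" for g
  \<comment> \<open>In the chart \<open>a \<mapsto> s a j\<close>, \<open>U j g\<close> is the image
    of the union of \<open>S\<close> and its right translate by \<open>g\<close>, and
    \<open>V j g\<close> is the image of their intersection.\<close>
  define U where "U j g = (\<lambda>a. s a j) ` (S \<union> R g)" for j g
  define V where "V j g = (\<lambda>a. s a j) ` (S \<inter> R g)" for j g
  define P where "P = {\<pi> :: nat \<Rightarrow> nat. \<pi> permutes {1..n}}"
  define bad where "bad \<pi> j g \<longleftrightarrow> (\<exists>u\<in>U j g - V j g. \<forall>v\<in>U j g. \<pi> u \<le> \<pi> v)"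
    for \<pi> :: "nat \<Rightarrow> nat" and j g
  have finP: "finite P" unfolding P_def by (rule finite_permutations) simp
  have "id \<in> P" by (simp add: P_def permutes_id)
  then have neP: "P \<noteq> {}" by blast
  have finR: "finite (R g)" for g using S by (simp add: R_def)
  have Rsub: "R g \<subseteq> carrier \<Gamma>" if "g \<in> K" for g using that S K by (auto simp: R_def)
  \<comment> \<open>Nonnegativity of \<open>e\<close> is read off from the Foelner estimate, which
    needs some element of \<open>K\<close>; this is why empty \<open>K\<close> is treated separately
    below.\<close>
  have e0: "0 \<le> e" if "g \<in> K" for g
  proof -
    have "0 \<le> e * real (card S)" using foelner[OF that] by (rule order_trans[rotated]) simp
    moreover have "0 < real (card S)" using S by (simp add: card_gt_0_iff)
    ultimately show ?thesis by (metis mult_less_0_iff not_le)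
  qed
  have badP: "real (card {\<pi>\<in>P. bad \<pi> j g}) \<le> e * real (card P)" if jg: "j \<in> G" "g \<in> K" for j g
  proof -
    have "s a j \<in> {1..n}" if "a \<in> S \<union> R g" for a
    proof -
      have "a \<in> carrier \<Gamma>" using that S Rsub[OF jg(2)] by blast
      then show ?thesis using permutes_in_image[OF s] G jg(1) by blast
    qed
    then have "U j g \<subseteq> {1..n}" unfolding U_def by blast
    then have "card (U j g) * card {\<pi>. \<pi> permutes {1..n} \<and> bad \<pi> j g}
        \<le> card (U j g - V j g) * card P"
      unfolding bad_def P_def
      by (intro card_permutations_argmin_outside_le) (auto simp: U_def V_def)
    then have 1: "real (card (U j g)) * real (card {\<pi>\<in>P. bad \<pi> j g})
        \<le> real (card (U j g - V j g)) * real (card P)"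
      unfolding P_def by (simp flip: of_nat_mult)
    \<comment> \<open>Injectivity of the chart turns the ratio of
      \<open>card (U j g - V j g)\<close> to \<open>card (U j g)\<close> into that of the symmetric
      difference to the union of \<open>S\<close> and its translate, which the Foelner estimate
      bounds by \<open>e\<close>.\<close>
    have ij: "inj_on (\<lambda>a. s a j) (S \<union> R g)" using inj[OF jg] by (simp add: R_def)
    have cU: "card (U j g) = card (S \<union> R g)" unfolding U_def by (rule card_image[OF ij])
    have "U j g - V j g = (\<lambda>a. s a j) ` (S \<union> R g - S \<inter> R g)"
      unfolding U_def V_def by (rule inj_on_image_set_diff[OF ij, symmetric]) auto
    then have "card (U j g - V j g) = card (S \<union> R g - S \<inter> R g)"
      by (simp add: card_image[OF inj_on_subset[OF ij]])
    also have "S \<union> R g - S \<inter> R g = sym_diff S (R g)" by blast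
    finally have "real (card (U j g - V j g)) \<le> e * real (card S)"
      using foelner[OF jg(2)] by (simp add: R_def)
    also have "\<dots> \<le> e * real (card (U j g))"
    proof (rule mult_left_mono)
      show "real (card S) \<le> real (card (U j g))"
        unfolding cU using S finR by (simp add: card_mono)
      show "0 \<le> e" by (rule e0[OF jg(2)])
    qed
    finally have "real (card (U j g)) * real (card {\<pi>\<in>P. bad \<pi> j g})
        \<le> real (card (U j g)) * (e * real (card P))"
      using order_trans[OF 1 mult_right_mono[of _ "e * real (card (U j g))" "real (card P)"]]
      by (simp add: ac_simps)
    moreover have "0 < card (U j g)"
      unfolding cU using S finR by (simp add: card_gt_0_iff)
    ultimately show ?thesis by simp
  qed
  have finG: "finite G" using G finite_subset by blast
  show ?thesis
  proof (cases "K = {}")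
    case True
    then show ?thesis using S by (intro exI[of _ "\<lambda>_. SOME a. a \<in> S"]) (auto intro: someI)
  next
    case False
    then obtain g0 where g0: "g0 \<in> K" by blast
    have e0: "0 \<le> e" by (rule e0[OF g0])
    \<comment> \<open>The number of bad pairs is averaged over all orderings. Counting pairs, rather
      than points for one fixed \<open>g\<close>, yields a single ordering that serves every
      \<open>g\<close> in \<open>K\<close>.\<close>
    have "(\<Sum>\<pi>\<in>P. real (card {p\<in>G \<times> K. bad \<pi> (fst p) (snd p)}))
        = real (\<Sum>p\<in>G \<times> K. card {\<pi>\<in>P. bad \<pi> (fst p) (snd p)})"
      using sum_card_filter_swap[of P "G \<times> K" "\<lambda>\<pi> p. bad \<pi> (fst p) (snd p)"] finP finG K
      by (simp flip: of_nat_sum)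
    also have "\<dots> \<le> (\<Sum>p\<in>G \<times> K. e * real (card P))"
      unfolding of_nat_sum by (rule sum_mono) (auto intro: badP)
    also have "\<dots> = e * real (card K) * real (card G) * real (card P)"
      by (simp add: card_cartesian_product)
    finally obtain \<pi> where \<pi>: "\<pi> \<in> P"
      and bad\<pi>: "real (card {p\<in>G \<times> K. bad \<pi> (fst p) (snd p)}) \<le> e * real (card K) * real (card G)"
      using exists_le_average[OF finP neP] by blast
    have \<pi>inj: "\<pi> u = \<pi> v \<Longrightarrow> u = v" for u v
      using \<pi> permutes_inj[of \<pi>] by (simp add: P_def inj_eq)
    define a where "a j = arg_min_on (\<lambda>b. \<pi> (s b j)) S" for j
    have aS: "a j \<in> S" for j unfolding a_def using S by (intro arg_min_if_finite)
    have amin: "\<pi> (s (a j) j) \<le> \<pi> (s b j)" if "b \<in> S" for j b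
      unfolding a_def using S that by (intro arg_min_least)
    have eqv: "a (s g j) \<otimes>\<^bsub>\<Gamma>\<^esub> g = a j" if jg: "j \<in> G" "g \<in> K" and nb: "\<not> bad \<pi> j g" for j g
    proof -
      have ij: "inj_on (\<lambda>a. s a j) (S \<union> R g)" using inj[OF jg] by (simp add: R_def)
      have fU: "finite (U j g)" "U j g \<noteq> {}" unfolding U_def using S finR by auto
      define u where "u = arg_min_on \<pi> (U j g)"
      have u: "u \<in> U j g" "\<And>v. v \<in> U j g \<Longrightarrow> \<pi> u \<le> \<pi> v"
        unfolding u_def using fU by (auto intro: arg_min_if_finite arg_min_least)
      then have "u \<in> V j g" using nb unfolding bad_def by blast
      then obtain b where b: "b \<in> S" "b \<in> R g" "u = s b j" unfolding V_def by blast
      \<comment> \<open>The first point \<open>u\<close> of the larger set \<open>U j g\<close> is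
        reached from \<open>b\<close> in \<open>S\<close>, so it is also the first point among the
        candidates of \<open>j\<close>.\<close>
      have 1: "a j = b"
      proof -
        have "\<pi> (s (a j) j) = \<pi> u"
          using amin[OF b(1), of j] u(2)[of "s (a j) j"] aS[of j] b(3) by (force simp: U_def)
        then show ?thesis using \<pi>inj b ij aS[of j] by (auto dest: inj_onD)
      qed
      \<comment> \<open>Multiplicativity identifies the candidates of \<open>s g j\<close> with the
        points of the translate seen from \<open>j\<close>. Via \<open>b'\<close> the point
        \<open>u\<close> is among them, and it comes first there too.\<close>
      obtain b' where b': "b' \<in> S" "b = b' \<otimes>\<^bsub>\<Gamma>\<^esub> g" using b(2) by (auto simp: R_def)
      have R: "a (s g j) \<otimes>\<^bsub>\<Gamma>\<^esub> g \<in> R g" using aS by (auto simp: R_def)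
      have "\<pi> (s (a (s g j) \<otimes>\<^bsub>\<Gamma>\<^esub> g) j) \<le> \<pi> u"
        using amin[OF b'(1), of "s g j"] mult[OF jg aS] mult[OF jg b'(1)] b' b by simp
      moreover have "\<pi> u \<le> \<pi> (s (a (s g j) \<otimes>\<^bsub>\<Gamma>\<^esub> g) j)"
        using R by (intro u(2)) (auto simp: U_def)
      ultimately have "s (a (s g j) \<otimes>\<^bsub>\<Gamma>\<^esub> g) j = s b j" using \<pi>inj b by (metis antisym)
      then show ?thesis using 1 ij R b by (auto dest: inj_onD)
    qed
    have "real (card {j\<in>{1..n}. a (s g j) \<otimes>\<^bsub>\<Gamma>\<^esub> g \<noteq> a j})
      \<le> e * real (card K) * real n + real (card ({1..n} - G))" if g: "g \<in> K" for g
    proof -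
      have "{j\<in>{1..n}. a (s g j) \<otimes>\<^bsub>\<Gamma>\<^esub> g \<noteq> a j} \<subseteq>
          fst ` {p\<in>G \<times> K. bad \<pi> (fst p) (snd p)} \<union> ({1..n} - G)"
        using eqv g by force
      then have "card {j\<in>{1..n}. a (s g j) \<otimes>\<^bsub>\<Gamma>\<^esub> g \<noteq> a j} \<le>
          card (fst ` {p\<in>G \<times> K. bad \<pi> (fst p) (snd p)} \<union> ({1..n} - G))"
        using finG K by (intro card_mono) auto
      also have "\<dots> \<le> card (fst ` {p\<in>G \<times> K. bad \<pi> (fst p) (snd p)}) + card ({1..n} - G)"
        by (rule card_Un_le)
      also have "\<dots> \<le> card {p\<in>G \<times> K. bad \<pi> (fst p) (snd p)} + card ({1..n} - G)"
        using finG K by (intro add_right_mono card_image_le) auto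
      finally have "real (card {j\<in>{1..n}. a (s g j) \<otimes>\<^bsub>\<Gamma>\<^esub> g \<noteq> a j}) \<le>
          real (card {p\<in>G \<times> K. bad \<pi> (fst p) (snd p)}) + real (card ({1..n} - G))" by linarith
      also have "\<dots> \<le> e * real (card K) * real (card G) + real (card ({1..n} - G))"
        using bad\<pi> by simp
      also have "\<dots> \<le> e * real (card K) * real n + real (card ({1..n} - G))"
        using card_mono[OF _ G] e0 by (intro add_right_mono mult_left_mono) auto
      finally show ?thesis .
    qed
    then show ?thesis using aS by blast
  qed
qed

section \<open>Vanishing densities in sofic approximations\<close>

lemma unif_mono: "A \<inter> {1..n} \<subseteq> B \<Longrightarrow> unif n A \<le> unif n B"
  unfolding unif_def by (intro divide_right_mono) (auto intro!: card_mono)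

lemma unif_nonneg: "0 \<le> unif n A"
  by (simp add: unif_def)

lemma unif_Un_le: "unif n (A \<union> B) \<le> unif n A + unif n B"
  using card_Un_le[of "A \<inter> {1..n}" "B \<inter> {1..n}"]
  by (simp add: unif_def Int_Un_distrib2 divide_right_mono flip: add_divide_distrib of_nat_add)

text \<open>Sofic limits equal to 1 are used through their exceptional sets, since these are stable
  under finite unions. \<open>unif\<close> intersects with \<open>{1..d i}\<close>, so
  \<open>B i\<close> may contain other points.\<close>

definition vanishing :: "(nat \<Rightarrow> nat) \<Rightarrow> (nat \<Rightarrow> nat set) \<Rightarrow> bool" where
  "vanishing d B \<longleftrightarrow> (\<lambda>i. unif (d i) (B i)) \<longlonglongrightarrow> 0"

lemma vanishing_bound:
  assumes "(\<lambda>i. f i) \<longlonglongrightarrow> 0" "\<And>i. unif (d i) (B i) \<le> f i"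
  shows "vanishing d B"
  unfolding vanishing_def
  by (rule tendsto_sandwich[OF _ _ tendsto_const assms(1)]) (auto simp: assms(2) unif_nonneg)

lemma vanishing_subset:
  assumes "vanishing d B" "\<And>i. A i \<inter> {1..d i} \<subseteq> B i"
  shows "vanishing d A"
  using assms(1)[unfolded vanishing_def] by (rule vanishing_bound) (rule unif_mono[OF assms(2)])

lemma vanishing_Un:
  assumes "vanishing d A" "vanishing d B"
  shows "vanishing d (\<lambda>i. A i \<union> B i)"
proof (rule vanishing_bound)
  show "(\<lambda>i. unif (d i) (A i) + unif (d i) (B i)) \<longlonglongrightarrow> 0"
    using tendsto_add[OF assms[unfolded vanishing_def]] by simp
qed (rule unif_Un_le)

lemma vanishing_UN:
  assumes "finite P" "\<And>p. p \<in> P \<Longrightarrow> vanishing d (B p)"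
  shows "vanishing d (\<lambda>i. \<Union>p\<in>P. B p i)"
  using assms
proof (induction P)
  case empty
  then show ?case by (simp add: vanishing_def unif_def)
next
  case (insert p P)
  then show ?case using vanishing_Un[of d "B p" "\<lambda>i. \<Union>p\<in>P. B p i"] by simp
qed

lemma vanishing_complement:
  assumes "(\<lambda>i. unif (d i) (A i)) \<longlonglongrightarrow> 1" "\<And>i. d i \<ge> 1"
  shows "vanishing d (\<lambda>i. {1..d i} - A i)"
proof (rule vanishing_bound)
  show "(\<lambda>i. 1 - unif (d i) (A i)) \<longlonglongrightarrow> 0"
    using tendsto_diff[OF tendsto_const assms(1), of 1] by simp
  fix i
  have "card {1..d i} = card (A i \<inter> {1..d i}) + card (({1..d i} - A i) \<inter> {1..d i})"
    by (subst card_Un_disjoint[symmetric]) (auto intro!: arg_cong[where f = card] simp del: card_atLeastAtMost)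
  then have "real (d i) = real (card (A i \<inter> {1..d i})) + real (card (({1..d i} - A i) \<inter> {1..d i}))"
    by (simp flip: of_nat_add)
  then show "unif (d i) ({1..d i} - A i) \<le> 1 - unif (d i) (A i)"
    using assms(2)[of i] by (simp add: unif_def field_simps)
qed

lemma vanishing_preimage:
  assumes "vanishing d B" "\<And>i. s i permutes {1..d i}"
  shows "vanishing d (\<lambda>i. {j\<in>{1..d i}. s i j \<in> B i})"
proof (rule vanishing_bound[OF assms(1)[unfolded vanishing_def]])
  fix i
  have "card {j\<in>{1..d i}. s i j \<in> B i} \<le> card (B i \<inter> {1..d i})"
  proof (rule card_inj_on_le)
    show "inj_on (s i) {j\<in>{1..d i}. s i j \<in> B i}"
      using permutes_inj[OF assms(2)] by (rule inj_on_subset) simp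
    show "s i ` {j\<in>{1..d i}. s i j \<in> B i} \<subseteq> B i \<inter> {1..d i}"
      using permutes_in_image[OF assms(2)] by blast
  qed simp
  moreover have "{j\<in>{1..d i}. s i j \<in> B i} \<inter> {1..d i} = {j\<in>{1..d i}. s i j \<in> B i}" by blast
  ultimately show "unif (d i) {j\<in>{1..d i}. s i j \<in> B i} \<le> unif (d i) (B i)"
    by (simp add: unif_def divide_right_mono)
qed

lemma sofic_vanishing_not_multiplicative:
  assumes "sofic_approximation \<Gamma> d \<sigma>" "g \<in> carrier \<Gamma>" "h \<in> carrier \<Gamma>"
  shows "vanishing d (\<lambda>i. {j\<in>{1..d i}. \<sigma> i (g \<otimes>\<^bsub>\<Gamma>\<^esub> h) j \<noteq> \<sigma> i g (\<sigma> i h j)})"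
proof -
  have "vanishing d (\<lambda>i. {1..d i} - {j\<in>{1..d i}. \<sigma> i (g \<otimes>\<^bsub>\<Gamma>\<^esub> h) j = \<sigma> i g (\<sigma> i h j)})"
    using assms by (intro vanishing_complement) (auto simp: sofic_approximation_def)
  then show ?thesis by (rule vanishing_subset) auto
qed

text \<open>Put \<open>c = b \<otimes> inv a\<close>, which is not the identity. If
  \<open>\<sigma> i a j = \<sigma> i b j\<close>, then either multiplicativity for the pair
  \<open>c\<close>, \<open>a\<close> fails at \<open>j\<close>, or \<open>\<sigma> i a j\<close> is
  a fixed point of \<open>\<sigma> i c\<close>. The second set is the preimage of a vanishing set
  under a permutation.\<close>

lemma sofic_vanishing_not_injective:
  fixes \<Gamma> (structure)
  assumes "group \<Gamma>" and sof: "sofic_approximation \<Gamma> d \<sigma>"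
    and ab: "a \<in> carrier \<Gamma>" "b \<in> carrier \<Gamma>" "a \<noteq> b"
  shows "vanishing d (\<lambda>i. {j\<in>{1..d i}. \<sigma> i a j = \<sigma> i b j})"
proof -
  interpret group \<Gamma> by fact
  define c where "c = b \<otimes> inv a"
  have c: "c \<in> carrier \<Gamma>" "c \<otimes> a = b" using ab by (auto simp: c_def m_assoc)
  then have "c \<noteq> \<one>" using ab by auto
  then have "vanishing d (\<lambda>i. {1..d i} - {j\<in>{1..d i}. \<sigma> i c j \<noteq> j})"
    using sof c by (intro vanishing_complement) (auto simp: sofic_approximation_def)
  then have fixed: "vanishing d (\<lambda>i. {j\<in>{1..d i}. \<sigma> i c j = j})"
    by (rule vanishing_subset) auto
  have perm: "\<And>i. \<sigma> i a permutes {1..d i}" using sof ab by (auto simp: sofic_approximation_def)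
  have "vanishing d (\<lambda>i. {j\<in>{1..d i}. \<sigma> i (c \<otimes> a) j \<noteq> \<sigma> i c (\<sigma> i a j)}
      \<union> {j\<in>{1..d i}. \<sigma> i a j \<in> {j\<in>{1..d i}. \<sigma> i c j = j}})"
    using sofic_vanishing_not_multiplicative[OF sof c(1) ab(1)]
      vanishing_preimage[OF fixed perm] by (rule vanishing_Un)
  then show ?thesis
    using permutes_in_image[OF perm] c(2) by (elim vanishing_subset) auto
qed

lemma vanishing_eventually_le:
  assumes "vanishing d B" "e > 0" "\<And>i. d i \<ge> 1" "\<And>i. B i \<subseteq> {1..d i}"
  shows "\<forall>\<^sub>F i in sequentially. real (card (B i)) \<le> e * real (d i)"
proof -
  have "\<forall>\<^sub>F i in sequentially. unif (d i) (B i) < e"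
    using assms(1,2) unfolding vanishing_def by (rule order_tendstoD)
  then show ?thesis
  proof eventually_elim
    case (elim i)
    have "B i \<inter> {1..d i} = B i" using assms(4) by blast
    then show ?case using elim assms(3)[of i] by (simp add: unif_def field_simps)
  qed
qed

section \<open>Operator norms in the left regular representation\<close>

lemma norm_sum_mult_square_le:
  fixes a b :: "'a \<Rightarrow> complex"
  shows "(cmod (\<Sum>g\<in>A. a g * b g))\<^sup>2 \<le> (\<Sum>g\<in>A. (cmod (a g))\<^sup>2) * (\<Sum>g\<in>A. (cmod (b g))\<^sup>2)"
proof -
  have "cmod (\<Sum>g\<in>A. a g * b g) \<le> (\<Sum>g\<in>A. cmod (a g) * cmod (b g))"
    using norm_sum[of "\<lambda>g. a g * b g" A] by (simp add: norm_mult)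
  then have "(cmod (\<Sum>g\<in>A. a g * b g))\<^sup>2 \<le> (\<Sum>g\<in>A. cmod (a g) * cmod (b g))\<^sup>2"
    by (rule power_mono) simp
  also have "\<dots> \<le> (\<Sum>g\<in>A. (cmod (a g))\<^sup>2) * (\<Sum>g\<in>A. (cmod (b g))\<^sup>2)"
    by (rule Cauchy_Schwarz_ineq_sum)
  finally show ?thesis .
qed

lemma has_sum_finite_sum:
  fixes f :: "'i \<Rightarrow> 'a \<Rightarrow> 'b :: topological_comm_monoid_add"
  assumes "finite I" "\<And>i. i \<in> I \<Longrightarrow> (f i has_sum s i) A"
  shows "((\<lambda>x. \<Sum>i\<in>I. f i x) has_sum (\<Sum>i\<in>I. s i)) A"
  using assms by (induction I) (auto intro: has_sum_add has_sum_0)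

text \<open>A crude bound showing that the supremum defining the operator norm is over a bounded set
  of reals. Cauchy-Schwarz is applied at each \<open>h\<close>; every left translate of \<xi> has
  the norm of \<xi>, which produces the factor counting the keys.\<close>

lemma left_regular_bounded:
  fixes \<Gamma> (structure)
  assumes "group \<Gamma>" and \<alpha>: "\<alpha> \<in> group_algebra \<Gamma>" and \<xi>: "l2_vector \<Gamma> \<xi>"
  shows "l2_norm \<Gamma> (left_regular \<Gamma> \<alpha> \<xi>)
    \<le> sqrt ((\<Sum>g\<in>Poly_Mapping.keys \<alpha>. (cmod (Poly_Mapping.lookup \<alpha> g))\<^sup>2)
        * real (card (Poly_Mapping.keys \<alpha>))) * l2_norm \<Gamma> \<xi>"
proof -
  interpret group \<Gamma> by fact
  define A where "A = Poly_Mapping.keys \<alpha>"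
  define N where "N = (\<Sum>g\<in>A. (cmod (Poly_Mapping.lookup \<alpha> g))\<^sup>2)"
  define f where "f g h = (cmod (\<xi> (inv g \<otimes> h)))\<^sup>2" for g h
  have A: "A \<subseteq> carrier \<Gamma>" "finite A" using \<alpha> by (auto simp: A_def group_algebra_def)
  have bij: "bij_betw (\<lambda>h. inv g \<otimes> h) (carrier \<Gamma>) (carrier \<Gamma>)" if "g \<in> carrier \<Gamma>" for g
    by (rule bij_betw_byWitness[where f' = "\<lambda>h. g \<otimes> h"])
      (use that in \<open>auto simp flip: m_assoc\<close>)
  have f: "f g summable_on carrier \<Gamma>"
    "infsum (f g) (carrier \<Gamma>) = infsum (\<lambda>h. (cmod (\<xi> h))\<^sup>2) (carrier \<Gamma>)" if "g \<in> A" for g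
  proof -
    have g: "g \<in> carrier \<Gamma>" using A that by blast
    show "f g summable_on carrier \<Gamma>"
      using summable_on_reindex_bij_betw[OF bij[OF g], of "\<lambda>h. (cmod (\<xi> h))\<^sup>2"] \<xi>
      by (simp add: l2_vector_def f_def[abs_def])
    show "infsum (f g) (carrier \<Gamma>) = infsum (\<lambda>h. (cmod (\<xi> h))\<^sup>2) (carrier \<Gamma>)"
      using infsum_reindex_bij_betw[OF bij[OF g], of "\<lambda>h. (cmod (\<xi> h))\<^sup>2"]
      by (simp add: f_def[abs_def])
  qed
  have hs: "((\<lambda>h. N * (\<Sum>g\<in>A. f g h)) has_sum
      (N * (\<Sum>g\<in>A. infsum (f g) (carrier \<Gamma>)))) (carrier \<Gamma>)"
    using f A by (intro has_sum_cmult_right has_sum_finite_sum has_sum_infsum) auto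
  note sf = has_sum_imp_summable[OF hs]
  have le: "(cmod (left_regular \<Gamma> \<alpha> \<xi> h))\<^sup>2 \<le> N * (\<Sum>g\<in>A. f g h)" for h
    unfolding left_regular_def N_def f_def A_def by (rule norm_sum_mult_square_le)
  have "infsum (\<lambda>h. (cmod (left_regular \<Gamma> \<alpha> \<xi> h))\<^sup>2) (carrier \<Gamma>)
      \<le> infsum (\<lambda>h. N * (\<Sum>g\<in>A. f g h)) (carrier \<Gamma>)"
    by (intro infsum_mono summable_on_comparison_test[OF sf] sf le) auto
  also have "\<dots> = N * (\<Sum>g\<in>A. infsum (f g) (carrier \<Gamma>))"
    by (rule infsumI[OF hs])
  also have "\<dots> = N * real (card A) * infsum (\<lambda>h. (cmod (\<xi> h))\<^sup>2) (carrier \<Gamma>)"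
    using f by simp
  finally show ?thesis
    unfolding l2_norm_def N_def A_def by (metis real_sqrt_le_iff real_sqrt_mult)
qed

lemma left_regular_le_opnorm:
  fixes \<Gamma> (structure)
  assumes "group \<Gamma>" and \<alpha>: "\<alpha> \<in> group_algebra \<Gamma>" and \<xi>: "l2_vector \<Gamma> \<xi>" "l2_norm \<Gamma> \<xi> \<le> 1"
  shows "l2_norm \<Gamma> (left_regular \<Gamma> \<alpha> \<xi>) \<le> left_regular_opnorm \<Gamma> \<alpha>"
proof -
  have "bdd_above {l2_norm \<Gamma> (left_regular \<Gamma> \<alpha> \<xi>) | \<xi>. l2_vector \<Gamma> \<xi> \<and> l2_norm \<Gamma> \<xi> \<le> 1}"
  proof (rule bdd_aboveI, clarify)
    fix \<xi> assume \<xi>: "l2_vector \<Gamma> \<xi>" "l2_norm \<Gamma> \<xi> \<le> 1"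
    show "l2_norm \<Gamma> (left_regular \<Gamma> \<alpha> \<xi>)
      \<le> sqrt ((\<Sum>g\<in>Poly_Mapping.keys \<alpha>. (cmod (Poly_Mapping.lookup \<alpha> g))\<^sup>2)
        * real (card (Poly_Mapping.keys \<alpha>))) * 1"
      by (rule order_trans[OF left_regular_bounded[OF assms(1) \<alpha> \<xi>(1)] mult_left_mono[OF \<xi>(2)]])
        (auto intro!: mult_nonneg_nonneg sum_nonneg)
  qed
  then show ?thesis unfolding left_regular_opnorm_def using \<xi> by (intro cSup_upper) blast+
qed

lemma left_regular_opnorm_nonneg:
  assumes "group \<Gamma>" "\<alpha> \<in> group_algebra \<Gamma>"
  shows "0 \<le> left_regular_opnorm \<Gamma> \<alpha>"
proof -
  have "l2_norm \<Gamma> (left_regular \<Gamma> \<alpha> (\<lambda>_. 0)) \<le> left_regular_opnorm \<Gamma> \<alpha>"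
    by (rule left_regular_le_opnorm[OF assms]) (auto simp: l2_vector_def l2_norm_def)
  then show ?thesis by (simp add: left_regular_def l2_norm_def)
qed

lemma l2_norm_scale:
  "l2_norm \<Gamma> (\<lambda>h. complex_of_real c * \<xi> h) = \<bar>c\<bar> * l2_norm \<Gamma> \<xi>"
  by (simp add: l2_norm_def norm_mult power_mult_distrib infsum_cmult_right' real_sqrt_mult)

lemma l2_norm_left_regular_le:
  fixes \<Gamma> (structure)
  assumes "group \<Gamma>" and \<alpha>: "\<alpha> \<in> group_algebra \<Gamma>" and \<xi>: "l2_vector \<Gamma> \<xi>"
  shows "l2_norm \<Gamma> (left_regular \<Gamma> \<alpha> \<xi>) \<le> left_regular_opnorm \<Gamma> \<alpha> * l2_norm \<Gamma> \<xi>"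
proof (cases "l2_norm \<Gamma> \<xi> = 0")
  \<comment> \<open>A vector of norm zero cannot be normalised; the crude bound shows that its image
    has norm at most zero.\<close>
  case True
  then show ?thesis using left_regular_bounded[OF assms] by simp
next
  case False
  define c where "c = l2_norm \<Gamma> \<xi>"
  have "0 \<le> c" unfolding c_def l2_norm_def by (auto intro!: infsum_nonneg)
  then have c: "0 < c" using False by (simp add: c_def)
  define \<zeta> where "\<zeta> h = complex_of_real (1 / c) * \<xi> h" for h
  have "(\<lambda>h. (cmod (\<zeta> h))\<^sup>2) = (\<lambda>h. (1 / c)\<^sup>2 * (cmod (\<xi> h))\<^sup>2)"
    by (simp add: \<zeta>_def norm_divide norm_mult power_mult_distrib power_divide)
  then have "l2_vector \<Gamma> \<zeta>" using \<xi>
    by (simp add: l2_vector_def summable_on_cmult_right del: power_divide power_one)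
  moreover have "l2_norm \<Gamma> \<zeta> \<le> 1"
    unfolding \<zeta>_def l2_norm_scale using c by (simp flip: c_def)
  ultimately have "l2_norm \<Gamma> (left_regular \<Gamma> \<alpha> \<zeta>) \<le> left_regular_opnorm \<Gamma> \<alpha>"
    by (rule left_regular_le_opnorm[OF assms(1) \<alpha>])
  moreover have "left_regular \<Gamma> \<alpha> \<zeta> = (\<lambda>h. complex_of_real (1 / c) * left_regular \<Gamma> \<alpha> \<xi> h)"
    unfolding left_regular_def \<zeta>_def by (simp add: sum_distrib_left ac_simps)
  ultimately have "l2_norm \<Gamma> (left_regular \<Gamma> \<alpha> \<xi>) / c \<le> left_regular_opnorm \<Gamma> \<alpha>"
    using c by (simp add: l2_norm_scale del: of_real_divide)
  then show ?thesis using c by (simp add: field_simps flip: c_def)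
qed

section \<open>Transfer of norm bounds from the regular representation to permutation
  operators\<close>

lemma infsum_finite_support:
  fixes f :: "'a \<Rightarrow> real"
  assumes "finite F" "F \<subseteq> A"
  shows "infsum (\<lambda>h. if h \<in> F then f h else 0) A = sum f F"
    "(\<lambda>h. if h \<in> F then f h else 0) summable_on A"
proof -
  have "infsum (\<lambda>h. if h \<in> F then f h else 0) A = infsum f F"
    using assms by (intro infsum_cong_neutral) auto
  then show "infsum (\<lambda>h. if h \<in> F then f h else 0) A = sum f F" using assms by simp
  show "(\<lambda>h. if h \<in> F then f h else 0) summable_on A"
    using assms by (subst summable_on_cong_neutral[where T = F and g = f]) auto
qed

text \<open>This is the squared operator norm inequality for a vector cut off to \<open>F\<close>,
  with both sides as finite sums. Summing over only part of the support of the image preserves the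
  upper bound.\<close>

lemma sum_left_regular_finite_support_le:
  fixes \<Gamma> (structure)
  assumes "group \<Gamma>" and \<alpha>: "\<alpha> \<in> group_algebra \<Gamma>"
    and F: "finite F" "F \<subseteq> carrier \<Gamma>" and F': "finite F'" "F' \<subseteq> carrier \<Gamma>"
  shows "(\<Sum>h\<in>F'. (cmod (left_regular \<Gamma> \<alpha> (\<lambda>h. if h \<in> F then \<xi> h else 0) h))\<^sup>2)
    \<le> (left_regular_opnorm \<Gamma> \<alpha>)\<^sup>2 * (\<Sum>h\<in>F. (cmod (\<xi> h))\<^sup>2)"
proof -
  interpret group \<Gamma> by fact
  define \<zeta> where "\<zeta> h = (if h \<in> F then \<xi> h else 0)" for h
  define \<omega> where "\<omega> = left_regular \<Gamma> \<alpha> \<zeta>"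
  have sq: "(\<lambda>h. (cmod (\<zeta> h))\<^sup>2) = (\<lambda>h. if h \<in> F then (cmod (\<xi> h))\<^sup>2 else 0)"
    by (auto simp: \<zeta>_def)
  have \<zeta>: "l2_vector \<Gamma> \<zeta>" "(l2_norm \<Gamma> \<zeta>)\<^sup>2 = (\<Sum>h\<in>F. (cmod (\<xi> h))\<^sup>2)"
    using infsum_finite_support[OF F, of "\<lambda>h. (cmod (\<xi> h))\<^sup>2"]
    by (auto simp: l2_vector_def l2_norm_def sq sum_nonneg)
  \<comment> \<open>The products of keys of \<alpha> with elements of \<open>F\<close> contain the
    support of \<omega>; \<open>F'\<close> is added so that the sum over \<open>T\<close> dominates
    the sum over \<open>F'\<close>.\<close>
  define T where "T = F' \<union> (\<lambda>(g, h). g \<otimes> h) ` (Poly_Mapping.keys \<alpha> \<times> F)"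
  have keys: "Poly_Mapping.keys \<alpha> \<subseteq> carrier \<Gamma>" using \<alpha> by (simp add: group_algebra_def)
  have T: "finite T" "T \<subseteq> carrier \<Gamma>" using F F' keys by (auto simp: T_def)
  have "\<omega> h = 0" if h: "h \<in> carrier \<Gamma> - T" for h
    unfolding \<omega>_def left_regular_def
  proof (rule sum.neutral, rule ballI)
    fix g assume g: "g \<in> Poly_Mapping.keys \<alpha>"
    have "inv g \<otimes> h \<notin> F"
    proof
      assume "inv g \<otimes> h \<in> F"
      moreover have "h = g \<otimes> (inv g \<otimes> h)" using g h keys by (auto simp flip: m_assoc)
      ultimately have "h \<in> T" using g by (force simp: T_def)
      then show False using h by blast
    qed
    then show "Poly_Mapping.lookup \<alpha> g * \<zeta> (inv g \<otimes> h) = 0" by (simp add: \<zeta>_def)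
  qed
  then have "infsum (\<lambda>h. (cmod (\<omega> h))\<^sup>2) (carrier \<Gamma>) = infsum (\<lambda>h. (cmod (\<omega> h))\<^sup>2) T"
    using T by (intro infsum_cong_neutral) auto
  then have "(l2_norm \<Gamma> \<omega>)\<^sup>2 = (\<Sum>h\<in>T. (cmod (\<omega> h))\<^sup>2)"
    using T by (simp add: l2_norm_def sum_nonneg)
  moreover have "(\<Sum>h\<in>F'. (cmod (\<omega> h))\<^sup>2) \<le> (\<Sum>h\<in>T. (cmod (\<omega> h))\<^sup>2)"
    using T by (intro sum_mono2) (auto simp: T_def)
  moreover have "(l2_norm \<Gamma> \<omega>)\<^sup>2 \<le> (left_regular_opnorm \<Gamma> \<alpha> * l2_norm \<Gamma> \<zeta>)\<^sup>2"
    unfolding \<omega>_def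
    by (intro power_mono l2_norm_left_regular_le assms \<zeta>) (auto simp: l2_norm_def intro!: infsum_nonneg)
  ultimately show ?thesis by (simp add: power_mult_distrib \<zeta>(2) flip: \<omega>_def \<zeta>_def)
qed

text \<open>A double count over \<open>h\<close> and \<open>j\<close>. Each \<open>s h\<close>
  permutes \<open>{1..n}\<close>, so summing over \<open>j\<close> gives the full norm for every
  \<open>h\<close>; for fixed \<open>j\<close> in \<open>G\<close>, the sum over \<open>h\<close> is
  bounded in the regular representation. The points outside \<open>G\<close> are charged
  \<open>C\<close> each.\<close>

lemma sum_perm_rep_square_le:
  fixes \<Gamma> (structure) and s :: "'g \<Rightarrow> nat \<Rightarrow> nat"
  assumes "group \<Gamma>" and \<alpha>: "\<alpha> \<in> group_algebra \<Gamma>"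
    and s: "\<And>g. g \<in> carrier \<Gamma> \<Longrightarrow> s g permutes {1..n}"
    and F: "finite F" "F \<subseteq> carrier \<Gamma>"
    and F': "F' \<subseteq> {h\<in>F. \<forall>g\<in>Poly_Mapping.keys \<alpha>. inv g \<otimes> h \<in> F}"
    and G: "G \<subseteq> {1..n}"
    and mult: "\<And>j g h. j \<in> G \<Longrightarrow> g \<in> Poly_Mapping.keys \<alpha> \<Longrightarrow> h \<in> F \<Longrightarrow>
      s g (s (inv g \<otimes> h) j) = s h j"
    and C: "\<And>j. j \<in> {1..n} \<Longrightarrow> (cmod (perm_rep n s \<alpha> \<xi> j))\<^sup>2 \<le> C"
  shows "real (card F') * (\<Sum>j\<in>{1..n}. (cmod (perm_rep n s \<alpha> \<xi> j))\<^sup>2)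
    \<le> (left_regular_opnorm \<Gamma> \<alpha>)\<^sup>2 * real (card F) * (\<Sum>j\<in>{1..n}. (cmod (\<xi> j))\<^sup>2)
      + real (card F') * C * real (card ({1..n} - G))"
proof -
  interpret group \<Gamma> by fact
  define L where "L = left_regular_opnorm \<Gamma> \<alpha>"
  define p where "p j = (cmod (perm_rep n s \<alpha> \<xi> j))\<^sup>2" for j
  have keys: "Poly_Mapping.keys \<alpha> \<subseteq> carrier \<Gamma>" using \<alpha> by (simp add: group_algebra_def)
  have F'F: "F' \<subseteq> F" "F' \<subseteq> carrier \<Gamma>" using F F' by auto
  then have finF': "finite F'" using F finite_subset by blast
  have inside: "s h j \<in> {1..n}" if "h \<in> carrier \<Gamma>" "j \<in> {1..n}" for h j
    using permutes_in_image[OF s[OF that(1)]] that(2) by blast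
  have shift: "(\<Sum>j\<in>{1..n}. f (s h j)) = (\<Sum>j\<in>{1..n}. f j)" if "h \<in> carrier \<Gamma>"
    for f :: "nat \<Rightarrow> real" and h
    using sum.permute[OF s[OF that], of f] by (simp add: o_def)
  \<comment> \<open>For \<open>h\<close> in \<open>F'\<close> all the translates
    \<open>inv g \<otimes> h\<close> stay in \<open>F\<close>, so the cutoff is invisible at
    \<open>h\<close>.\<close>
  have local: "perm_rep n s \<alpha> \<xi> (s h j)
      = left_regular \<Gamma> \<alpha> (\<lambda>h. if h \<in> F then \<xi> (s h j) else 0) h"
    if "j \<in> G" "h \<in> F'" for j h
    unfolding perm_rep_def left_regular_def
  proof (rule sum.cong[OF refl])
    fix g assume g: "g \<in> Poly_Mapping.keys \<alpha>"
    have gh: "inv g \<otimes> h \<in> F" using g that F' by blast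
    have inj: "inj_on (s g) {1..n}"
      using permutes_inj[OF s] g keys by (blast intro: inj_on_subset)
    have "inv_into {1..n} (s g) (s h j) = inv_into {1..n} (s g) (s g (s (inv g \<otimes> h) j))"
      using mult[OF that(1) g] that F'F by (metis subsetD)
    also have "\<dots> = s (inv g \<otimes> h) j"
      using gh F G that(1) by (intro inv_into_f_f[OF inj] inside) auto
    finally show "Poly_Mapping.lookup \<alpha> g * \<xi> (inv_into {1..n} (s g) (s h j))
      = Poly_Mapping.lookup \<alpha> g * (if inv g \<otimes> h \<in> F then \<xi> (s (inv g \<otimes> h) j) else 0)"
      using gh by simp
  qed
  have good: "(\<Sum>h\<in>F'. p (s h j)) \<le> L\<^sup>2 * (\<Sum>h\<in>F. (cmod (\<xi> (s h j)))\<^sup>2)" if "j \<in> G" for j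
    using sum_left_regular_finite_support_le[OF assms(1) \<alpha> F finF' F'F(2), of "\<lambda>h. \<xi> (s h j)"]
    by (simp add: p_def local[OF that] L_def)
  have bad: "(\<Sum>h\<in>F'. p (s h j)) \<le> real (card F') * C" if "j \<in> {1..n}" for j
    using F'F that by (intro sum_bounded_above) (auto simp: p_def intro!: C inside)
  have "real (card F') * (\<Sum>j\<in>{1..n}. p j) = (\<Sum>h\<in>F'. \<Sum>j\<in>{1..n}. p (s h j))"
  proof -
    have "(\<Sum>j\<in>{1..n}. p (s h j)) = (\<Sum>j\<in>{1..n}. p j)" if "h \<in> F'" for h
      using that F'F(2) by (intro shift) blast
    then show ?thesis by simp
  qed
  also have "\<dots> = (\<Sum>j\<in>{1..n}. \<Sum>h\<in>F'. p (s h j))" by (rule sum.swap)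
  also have "\<dots> = (\<Sum>j\<in>G. \<Sum>h\<in>F'. p (s h j)) + (\<Sum>j\<in>{1..n} - G. \<Sum>h\<in>F'. p (s h j))"
    using sum.subset_diff[OF G] by (simp add: add.commute)
  also have "\<dots> \<le> (\<Sum>j\<in>G. L\<^sup>2 * (\<Sum>h\<in>F. (cmod (\<xi> (s h j)))\<^sup>2)) + real (card ({1..n} - G)) * (real (card F') * C)"
    by (intro add_mono sum_mono sum_bounded_above good bad) auto
  also have "(\<Sum>j\<in>G. L\<^sup>2 * (\<Sum>h\<in>F. (cmod (\<xi> (s h j)))\<^sup>2))
      \<le> (\<Sum>j\<in>{1..n}. L\<^sup>2 * (\<Sum>h\<in>F. (cmod (\<xi> (s h j)))\<^sup>2))"
    using G by (intro sum_mono2) (auto intro!: mult_nonneg_nonneg sum_nonneg)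
  also have "\<dots> = L\<^sup>2 * (\<Sum>h\<in>F. \<Sum>j\<in>{1..n}. (cmod (\<xi> (s h j)))\<^sup>2)"
    by (subst sum.swap) (simp add: sum_distrib_left)
  also have "(\<Sum>h\<in>F. \<Sum>j\<in>{1..n}. (cmod (\<xi> (s h j)))\<^sup>2) = (\<Sum>h\<in>F. \<Sum>j\<in>{1..n}. (cmod (\<xi> j))\<^sup>2)"
    using F(2) by (intro sum.cong refl shift[where f = "\<lambda>j. (cmod (\<xi> j))\<^sup>2"]) auto
  finally show ?thesis by (simp add: p_def L_def algebra_simps)
qed

lemma cmod_perm_rep_le:
  assumes "\<alpha> \<in> group_algebra \<Gamma>" "\<And>g. g \<in> carrier \<Gamma> \<Longrightarrow> s g permutes {1..n}"
    and \<xi>: "\<And>j. j \<in> {1..n} \<Longrightarrow> cmod (\<xi> j) \<le> 1" and j: "j \<in> {1..n}"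
  shows "cmod (perm_rep n s \<alpha> \<xi> j)
    \<le> (\<Sum>g\<in>Poly_Mapping.keys \<alpha>. cmod (Poly_Mapping.lookup \<alpha> g))"
  unfolding perm_rep_def
proof (rule order_trans[OF norm_sum], rule sum_mono)
  fix g assume "g \<in> Poly_Mapping.keys \<alpha>"
  then have "s g ` {1..n} = {1..n}"
    using assms by (intro permutes_image) (auto simp: group_algebra_def)
  then have "inv_into {1..n} (s g) j \<in> {1..n}" using j by (intro inv_into_into) auto
  from mult_left_mono[OF \<xi>[OF this], of "cmod (Poly_Mapping.lookup \<alpha> g)"]
  show "cmod (Poly_Mapping.lookup \<alpha> g * \<xi> (inv_into {1..n} (s g) j))
    \<le> cmod (Poly_Mapping.lookup \<alpha> g)" by (simp add: norm_mult)
qed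

text \<open>A point \<open>h\<close> of \<open>F\<close> with \<open>inv g \<otimes> h\<close>
  outside \<open>F\<close> lies outside \<open>g <# F\<close>. The boundary is therefore covered by
  the symmetric differences for \<open>g\<close> in \<open>K\<close>.\<close>

lemma amenable_foelner_interior:
  fixes \<Gamma> (structure)
  assumes "amenable \<Gamma>" and K: "finite K" "K \<subseteq> carrier \<Gamma>" and "0 < e"
  obtains F where "finite F" "F \<noteq> {}" "F \<subseteq> carrier \<Gamma>"
    "real (card (F - {h\<in>F. \<forall>g\<in>K. inv g \<otimes> h \<in> F})) \<le> e * real (card F)"
proof -
  interpret group \<Gamma> using assms(1) by (simp add: amenable_def)
  \<comment> \<open>The tolerance is divided in advance to pay for the union over \<open>K\<close>;
    adding 1 keeps the denominator positive when \<open>K\<close> is empty.\<close>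
  have "0 < e / (real (card K) + 1)" using \<open>0 < e\<close> by simp
  then obtain F where F: "finite F" "F \<noteq> {}" "F \<subseteq> carrier \<Gamma>"
    and Foe: "\<And>g. g \<in> K \<Longrightarrow>
      real (card (sym_diff (g <# F) F)) \<le> e / (real (card K) + 1) * real (card F)"
    using assms(1) K unfolding amenable_def by meson
  have "F - {h\<in>F. \<forall>g\<in>K. inv g \<otimes> h \<in> F} \<subseteq> (\<Union>g\<in>K. sym_diff (g <# F) F)"
  proof
    fix h assume "h \<in> F - {h\<in>F. \<forall>g\<in>K. inv g \<otimes> h \<in> F}"
    then obtain g where g: "h \<in> F" "g \<in> K" "inv g \<otimes> h \<notin> F" by blast
    have "h \<notin> g <# F"
    proof
      assume "h \<in> g <# F"
      then obtain b where b: "b \<in> F" "h = g \<otimes> b" by (auto simp: l_coset_def)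
      have "inv g \<otimes> h = b" using g b K F by (simp add: subsetD flip: m_assoc)
      then show False using g b by simp
    qed
    then show "h \<in> (\<Union>g\<in>K. sym_diff (g <# F) F)" using g by blast
  qed
  moreover have fin: "finite (sym_diff (g <# F) F)" for g
    using F by (auto simp: l_coset_def)
  ultimately have "card (F - {h\<in>F. \<forall>g\<in>K. inv g \<otimes> h \<in> F}) \<le> card (\<Union>g\<in>K. sym_diff (g <# F) F)"
    using K by (intro card_mono) auto
  also have "\<dots> \<le> (\<Sum>g\<in>K. card (sym_diff (g <# F) F))"
    using K by (intro card_UN_le)
  finally have "real (card (F - {h\<in>F. \<forall>g\<in>K. inv g \<otimes> h \<in> F}))
      \<le> (\<Sum>g\<in>K. real (card (sym_diff (g <# F) F)))" by (simp flip: of_nat_sum)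
  also have "\<dots> \<le> real (card K) * (e / (real (card K) + 1) * real (card F))"
    by (rule sum_bounded_above[OF Foe])
  also have "\<dots> \<le> e * real (card F)"
    using \<open>0 < e\<close> by (simp add: field_simps)
  finally show ?thesis using that F by blast
qed

text \<open>Read in the local charts \<open>h \<mapsto> \<sigma> h j\<close>, a vector on \<open>{1..n}\<close> cut off to a Foelner set is a
  vector of \<open>\<ell>\<^sup>2(\<Gamma>)\<close> on which \<open>\<sigma>(\<alpha>)\<close> acts as \<open>\<lambda>(\<alpha>)\<close>; averaging over \<open>j\<close> bounds \<open>\<sigma>(\<alpha>)\<close> by
  \<open>\<parallel>\<lambda>(\<alpha>)\<parallel>\<close> up to the boundary of the Foelner set.\<close>

lemma amenable_eventually_perm_rep_le:
  fixes \<Gamma> (structure)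
  assumes "group \<Gamma>" and am: "amenable \<Gamma>" and sof: "sofic_approximation \<Gamma> d \<sigma>"
    and \<alpha>: "\<alpha> \<in> group_algebra \<Gamma>" and \<eta>: "0 < \<eta>"
  shows "\<forall>\<^sub>F i in sequentially. \<forall>\<xi>. (\<forall>j\<in>{1..d i}. cmod (\<xi> j) \<le> 1) \<longrightarrow>
    unif_norm2 (d i) (perm_rep (d i) (\<sigma> i) \<alpha> \<xi>)
      \<le> left_regular_opnorm \<Gamma> \<alpha> * unif_norm2 (d i) \<xi> + \<eta>"
proof -
  interpret group \<Gamma> by fact
  define A where "A = Poly_Mapping.keys \<alpha>"
  define C where "C = (\<Sum>g\<in>A. cmod (Poly_Mapping.lookup \<alpha> g))"
  \<comment> \<open>Here \<open>C\<close> bounds the image of any vector bounded by 1 pointwise. The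
    exceptional points and the boundary of the Foelner set each cost \<open>e * C\<^sup>2\<close>
    after normalisation, and \<open>e\<close> makes their sum at most
    \<open>\<eta>\<^sup>2\<close>.\<close>
  define e where "e = \<eta>\<^sup>2 / (2 * (C\<^sup>2 + 1))"
  define L where "L = left_regular_opnorm \<Gamma> \<alpha>"
  have A: "finite A" "A \<subseteq> carrier \<Gamma>" using \<alpha> by (auto simp: A_def group_algebra_def)
  have C21: "0 < C\<^sup>2 + 1" by (simp add: add_nonneg_pos)
  then have e: "0 < e" using \<eta> by (simp add: e_def)
  have eC: "2 * e * C\<^sup>2 \<le> \<eta>\<^sup>2"
    using C21 by (simp add: e_def field_simps)
  obtain F where F: "finite F" "F \<noteq> {}" "F \<subseteq> carrier \<Gamma>"
    and Fint: "real (card (F - {h\<in>F. \<forall>g\<in>A. inv g \<otimes> h \<in> F})) \<le> e * real (card F)"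
    by (rule amenable_foelner_interior[OF am A e])
  define F' where "F' = {h\<in>F. \<forall>g\<in>A. inv g \<otimes> h \<in> F}"
  \<comment> \<open>The points where \<sigma> fails to be multiplicative on some factorisation
    \<open>h = g \<otimes> (inv g \<otimes> h)\<close>. There are finitely many such factorisations,
    so \<open>B\<close> vanishes.\<close>
  define B where "B i = (\<Union>p\<in>A \<times> F. {j\<in>{1..d i}.
    \<sigma> i (fst p \<otimes> (inv (fst p) \<otimes> snd p)) j \<noteq> \<sigma> i (fst p) (\<sigma> i (inv (fst p) \<otimes> snd p) j)})" for i
  have d: "d i \<ge> 1" and perm: "g \<in> carrier \<Gamma> \<Longrightarrow> \<sigma> i g permutes {1..d i}" for i g
    using sof by (auto simp: sofic_approximation_def)
  have "vanishing d B"
    unfolding B_def using A F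
    by (intro vanishing_UN sofic_vanishing_not_multiplicative[OF sof]) (auto simp: subsetD)
  then have "\<forall>\<^sub>F i in sequentially. real (card (B i)) \<le> e * real (d i)"
    using e d by (rule vanishing_eventually_le) (auto simp: B_def)
  then show ?thesis
  proof (eventually_elim, intro allI impI)
    fix i and \<xi> :: "nat \<Rightarrow> complex"
    assume Bi: "real (card (B i)) \<le> e * real (d i)" and \<xi>: "\<forall>j\<in>{1..d i}. cmod (\<xi> j) \<le> 1"
    define n where "n = d i"
    define P where "P = (\<Sum>j\<in>{1..n}. (cmod (perm_rep n (\<sigma> i) \<alpha> \<xi> j))\<^sup>2)"
    define Q where "Q = (\<Sum>j\<in>{1..n}. (cmod (\<xi> j))\<^sup>2)"
    have n: "0 < real n" using d[of i] by (simp add: n_def)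
    have rep: "(cmod (perm_rep n (\<sigma> i) \<alpha> \<xi> j))\<^sup>2 \<le> C\<^sup>2" if "j \<in> {1..n}" for j
      unfolding C_def A_def using \<xi> that perm
      by (intro power_mono cmod_perm_rep_le[OF \<alpha>]) (auto simp: n_def)
    have PC: "P \<le> real n * C\<^sup>2"
      unfolding P_def using sum_bounded_above[of "{1..n}", OF rep] by simp
    have mult: "\<sigma> i g (\<sigma> i (inv g \<otimes> h) j) = \<sigma> i h j"
      if "j \<in> {1..n} - B i" "g \<in> A" "h \<in> F" for j g h
    proof -
      have gh: "g \<otimes> (inv g \<otimes> h) = h" using that A F by (simp add: subsetD flip: m_assoc)
      have "(g, h) \<in> A \<times> F" using that by simp
      then have "\<sigma> i (g \<otimes> (inv g \<otimes> h)) j = \<sigma> i g (\<sigma> i (inv g \<otimes> h) j)"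
        using that(1) unfolding B_def n_def by fastforce
      then show ?thesis using gh by simp
    qed
    have "real (card F') * P \<le> L\<^sup>2 * real (card F) * Q
        + real (card F') * C\<^sup>2 * real (card ({1..n} - ({1..n} - B i)))"
      unfolding P_def Q_def L_def
      by (rule sum_perm_rep_square_le[OF assms(1) \<alpha> _ F(1,3) _ _ _ rep])
        (use perm mult in \<open>auto simp: n_def F'_def A_def\<close>)
    also have "real (card F') * C\<^sup>2 * real (card ({1..n} - ({1..n} - B i)))
        \<le> real (card F) * C\<^sup>2 * (e * real n)"
    proof (intro mult_mono)
      have "{1..n} - ({1..n} - B i) = B i" by (auto simp: B_def n_def)
      then show "real (card ({1..n} - ({1..n} - B i))) \<le> e * real n"
        using Bi by (simp add: n_def)
      show "real (card F') \<le> real (card F)" using F by (auto simp: F'_def intro: card_mono)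
    qed auto
    finally have 1: "real (card F') * P \<le> L\<^sup>2 * real (card F) * Q + real (card F) * C\<^sup>2 * (e * real n)"
      by simp
    \<comment> \<open>The preceding estimate has the weight \<open>card F'\<close> on the left. The
      missing weight from the boundary is restored using the trivial bound on
      \<open>P\<close>.\<close>
    have "real (card (F - F')) * P \<le> (e * real (card F)) * (real n * C\<^sup>2)"
      using Fint PC by (intro mult_mono) (auto simp: F'_def P_def e less_imp_le sum_nonneg)
    moreover have "card F = card F' + card (F - F')"
      using F card_Diff_subset[of F' F] card_mono[of F F'] by (auto simp: F'_def)
    ultimately have "real (card F) * P \<le> real (card F) * (L\<^sup>2 * Q + 2 * e * C\<^sup>2 * real n)"
      using 1 by (simp add: algebra_simps)
    moreover have "0 < real (card F)" using F by (simp add: card_gt_0_iff)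
    ultimately have "P \<le> L\<^sup>2 * Q + 2 * e * C\<^sup>2 * real n" by simp
    also have "\<dots> \<le> L\<^sup>2 * Q + \<eta>\<^sup>2 * real n" using eC by (simp add: mult_right_mono)
    finally have "P / real n \<le> (L\<^sup>2 * Q + \<eta>\<^sup>2 * real n) / real n"
      using n by (simp add: divide_right_mono)
    also have "\<dots> = L\<^sup>2 * (Q / real n) + \<eta>\<^sup>2" using n by (simp add: field_simps)
    finally have "sqrt (P / real n) \<le> sqrt (L\<^sup>2 * (Q / real n) + \<eta>\<^sup>2)" by simp
    also have "\<dots> \<le> sqrt (L\<^sup>2 * (Q / real n)) + sqrt (\<eta>\<^sup>2)"
      by (rule sqrt_add_le_add_sqrt) (auto simp: Q_def sum_nonneg)
    also have "\<dots> = L * sqrt (Q / real n) + \<eta>"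
      using \<eta> left_regular_opnorm_nonneg[OF assms(1) \<alpha>] by (simp only: real_sqrt_mult) (simp add: L_def)
    finally show "unif_norm2 (d i) (perm_rep (d i) (\<sigma> i) \<alpha> \<xi>)
      \<le> left_regular_opnorm \<Gamma> \<alpha> * unif_norm2 (d i) \<xi> + \<eta>"
      by (simp add: unif_norm2_def P_def Q_def L_def n_def)
  qed
qed

section \<open>Weak containment for all subsets\<close>

lemma cmod_centered_indicator_le:
  assumes "n \<ge> 1"
  shows "cmod (centered_indicator n J j) \<le> 1"
proof -
  have "0 \<le> unif n J" "unif n J \<le> 1"
    using assms card_mono[of "{1..n}" "J \<inter> {1..n}"] by (auto simp: unif_def field_simps)
  moreover have "centered_indicator n J j = complex_of_real (indicator J j - unif n J)"
    by (simp add: centered_indicator_def indicator_def)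
  ultimately show ?thesis by (simp only: norm_of_real) (auto simp: indicator_def)
qed

text \<open>The threshold for \<open>i\<close> does not depend on \<open>J\<close>: the estimate
  above is uniform over vectors bounded by 1, and all centred indicators are such vectors.
  Finiteness of \<open>E\<close> gives one threshold for all \<alpha>.\<close>

lemma amenable_eventually_Lambda_at:
  assumes "group \<Gamma>" "amenable \<Gamma>" "sofic_approximation \<Gamma> d \<sigma>"
    and E: "finite E" "E \<subseteq> group_algebra \<Gamma>" and "0 < \<eta>"
  shows "\<forall>\<^sub>F i in sequentially. \<forall>J. J \<subseteq> {1..d i} \<longrightarrow> J \<in> Lambda_at \<Gamma> E \<eta> (d i) (\<sigma> i)"
proof -
  have d: "d i \<ge> 1" for i using assms(3) by (simp add: sofic_approximation_def)
  have "\<forall>\<^sub>F i in sequentially. \<forall>\<alpha>\<in>E. \<forall>\<xi>. (\<forall>j\<in>{1..d i}. cmod (\<xi> j) \<le> 1) \<longrightarrow>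
    unif_norm2 (d i) (perm_rep (d i) (\<sigma> i) \<alpha> \<xi>)
      \<le> left_regular_opnorm \<Gamma> \<alpha> * unif_norm2 (d i) \<xi> + \<eta>"
    using E assms by (intro eventually_ball_finite ballI amenable_eventually_perm_rep_le) auto
  then show ?thesis
    by eventually_elim (simp add: Lambda_at_def cmod_centered_indicator_le[OF d])
qed

section \<open>Approximately equivariant maps\<close>

lemma amenable_right_foelner:
  fixes \<Gamma> (structure)
  assumes "amenable \<Gamma>" and K: "finite K" "K \<subseteq> carrier \<Gamma>" and "0 < e"
  obtains S where "finite S" "S \<noteq> {}" "S \<subseteq> carrier \<Gamma>"
    "\<And>g. g \<in> K \<Longrightarrow> real (card (sym_diff S ((\<lambda>a. a \<otimes> g) ` S))) \<le> e * real (card S)"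
proof -
  interpret group \<Gamma> using assms(1) by (simp add: amenable_def)
  have "finite (m_inv \<Gamma> ` K) \<and> m_inv \<Gamma> ` K \<subseteq> carrier \<Gamma> \<and> 0 < e" using K \<open>0 < e\<close> by auto
  then obtain F where F: "finite F" "F \<noteq> {}" "F \<subseteq> carrier \<Gamma>"
    and foelner: "\<And>g. g \<in> K \<Longrightarrow> real (card (sym_diff (inv g <# F) F)) \<le> e * real (card F)"
    using assms(1) unfolding amenable_def by (metis imageI)
  define S where "S = m_inv \<Gamma> ` F"
  have cS: "card S = card F" unfolding S_def
    using F by (intro card_image inj_on_subset[OF inv_inj])
  have "real (card (sym_diff S ((\<lambda>a. a \<otimes> g) ` S))) \<le> e * real (card S)" if g: "g \<in> K" for g
  proof -
    have "inv b \<otimes> g = inv (inv g \<otimes> b)" if "b \<in> F" for b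
      using that g F K by (simp add: inv_mult_group subsetD)
    then have Sg: "(\<lambda>a. a \<otimes> g) ` S = m_inv \<Gamma> ` (inv g <# F)"
      by (auto simp: S_def l_coset_def image_iff)
    have "card (sym_diff S ((\<lambda>a. a \<otimes> g) ` S)) \<le> card (m_inv \<Gamma> ` sym_diff (inv g <# F) F)"
    proof (rule card_mono)
      show "finite (m_inv \<Gamma> ` sym_diff (inv g <# F) F)" using F by (auto simp: l_coset_def)
      show "sym_diff S ((\<lambda>a. a \<otimes> g) ` S) \<subseteq> m_inv \<Gamma> ` sym_diff (inv g <# F) F"
        unfolding Sg unfolding S_def by blast
    qed
    also have "\<dots> \<le> card (sym_diff (inv g <# F) F)"
      using F by (intro card_image_le) (auto simp: l_coset_def)
    finally show ?thesis using foelner[OF g] cS by simp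
  qed
  moreover have "finite S" "S \<noteq> {}" "S \<subseteq> carrier \<Gamma>" using F by (auto simp: S_def)
  ultimately show ?thesis using that by blast
qed

lemma eventually_almost_equivariant_selection:
  fixes \<Gamma> (structure) and \<sigma> :: "nat \<Rightarrow> 'g \<Rightarrow> nat \<Rightarrow> nat"
  assumes "group \<Gamma>" and am: "amenable \<Gamma>" and sof: "sofic_approximation \<Gamma> d \<sigma>"
    and K: "finite K" "K \<subseteq> carrier \<Gamma>" and "0 < \<theta>"
  shows "\<forall>\<^sub>F i in sequentially. \<exists>a :: nat \<Rightarrow> 'g. (\<forall>j. a j \<in> carrier \<Gamma>) \<and>
    (\<forall>g\<in>K. real (card {j\<in>{1..d i}. a (\<sigma> i g j) \<otimes> g \<noteq> a j}) \<le> \<theta> * real (d i))"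
proof -
  interpret group \<Gamma> by fact
  \<comment> \<open>The selection costs \<open>e * card K\<close> and the exceptional set costs
    \<open>e\<close>, adding up to \<theta>.\<close>
  define e where "e = \<theta> / (real (card K) + 1)"
  have e: "0 < e" using \<open>0 < \<theta>\<close> by (simp add: e_def)
  have "e * (real (card K) + 1) = \<theta>" unfolding e_def by (rule nonzero_eq_divide_eq[THEN iffD1]) auto
  then have e\<theta>: "e * real (card K) + e = \<theta>" by (simp add: distrib_left)
  obtain S where S: "finite S" "S \<noteq> {}" "S \<subseteq> carrier \<Gamma>"
    and foelner: "\<And>g. g \<in> K \<Longrightarrow>
      real (card (sym_diff S ((\<lambda>a. a \<otimes> g) ` S))) \<le> e * real (card S)"
    using amenable_right_foelner[OF am K e] by blast
  \<comment> \<open>\<open>T\<close> contains every group element whose image must be kept apart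
    from another, for all \<open>g\<close> in \<open>K\<close> at once.\<close>
  define T where "T = S \<union> (\<Union>g\<in>K. (\<lambda>a. a \<otimes> g) ` S)"
  have T: "finite T" "T \<subseteq> carrier \<Gamma>" using S K by (auto simp: T_def subsetD)
  define B where "B i =
    (\<Union>p\<in>S \<times> K. {j\<in>{1..d i}. \<sigma> i (fst p \<otimes> snd p) j \<noteq> \<sigma> i (fst p) (\<sigma> i (snd p) j)}) \<union>
    (\<Union>p\<in>{p\<in>T \<times> T. fst p \<noteq> snd p}. {j\<in>{1..d i}. \<sigma> i (fst p) j = \<sigma> i (snd p) j})" for i
  have d: "d i \<ge> 1" and perm: "g \<in> carrier \<Gamma> \<Longrightarrow> \<sigma> i g permutes {1..d i}" for i g
    using sof by (auto simp: sofic_approximation_def)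
  have "vanishing d B"
    unfolding B_def using S K T
    by (intro vanishing_Un vanishing_UN sofic_vanishing_not_multiplicative[OF sof]
        sofic_vanishing_not_injective[OF assms(1) sof]) (auto simp: subsetD)
  then have "\<forall>\<^sub>F i in sequentially. real (card (B i)) \<le> e * real (d i)"
    using e d by (rule vanishing_eventually_le) (auto simp: B_def)
  then show ?thesis
  proof eventually_elim
    case (elim i)
    have "\<exists>a :: nat \<Rightarrow> 'g. (\<forall>j. a j \<in> S) \<and>
      (\<forall>g\<in>K. real (card {j\<in>{1..d i}. a (\<sigma> i g j) \<otimes> g \<noteq> a j})
        \<le> e * real (card K) * real (d i) + real (card ({1..d i} - ({1..d i} - B i))))"
    proof (rule exists_almost_equivariant_selection[OF assms(1) S K perm foelner])
      fix j g assume jg: "j \<in> {1..d i} - B i" "g \<in> K"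
      show "inj_on (\<lambda>a. \<sigma> i a j) (S \<union> (\<lambda>a. a \<otimes> g) ` S)"
      proof (rule inj_onI, rule ccontr)
        fix a b
        assume "a \<in> S \<union> (\<lambda>a. a \<otimes> g) ` S" "b \<in> S \<union> (\<lambda>a. a \<otimes> g) ` S"
          and ab: "\<sigma> i a j = \<sigma> i b j" "a \<noteq> b"
        then have "(a, b) \<in> {p\<in>T \<times> T. fst p \<noteq> snd p}" using jg(2) by (auto simp: T_def)
        moreover have "j \<in> {j\<in>{1..d i}. \<sigma> i (fst (a, b)) j = \<sigma> i (snd (a, b)) j}"
          using ab jg(1) by simp
        ultimately have "j \<in> B i" unfolding B_def by blast
        then show False using jg(1) by blast
      qed
      fix a assume a: "a \<in> S"
      show "\<sigma> i a (\<sigma> i g j) = \<sigma> i (a \<otimes> g) j"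
      proof (rule ccontr)
        assume "\<sigma> i a (\<sigma> i g j) \<noteq> \<sigma> i (a \<otimes> g) j"
        then have "j \<in> {j\<in>{1..d i}. \<sigma> i (fst (a, g) \<otimes> snd (a, g)) j
            \<noteq> \<sigma> i (fst (a, g)) (\<sigma> i (snd (a, g)) j)}" using jg(1) by simp
        moreover have "(a, g) \<in> S \<times> K" using a jg by simp
        ultimately have "j \<in> B i" unfolding B_def by blast
        then show False using jg(1) by blast
      qed
    qed auto
    moreover have "e * real (card K) * real (d i) + real (card ({1..d i} - ({1..d i} - B i)))
        \<le> \<theta> * real (d i)"
    proof -
      have "{1..d i} - ({1..d i} - B i) = B i" by (auto simp: B_def)
      then show ?thesis using elim by (simp add: algebra_simps flip: e\<theta>)
    qed
    ultimately show ?case using S by (meson order_trans subsetD)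
  qed
qed

text \<open>Inverting \<open>a (\<sigma> i g j) \<otimes> g = a j\<close> shows that
  \<open>j \<mapsto> act (inv (a j)) x0\<close> is exactly equivariant at such \<open>j\<close>. The
  remaining points have proportion at most \<theta>, and each contributes at most
  \<open>D\<^sup>2\<close> to the mean square.\<close>

lemma eventually_Map_approx_nonempty:
  fixes \<Gamma> (structure) and \<sigma> :: "nat \<Rightarrow> 'g \<Rightarrow> nat \<Rightarrow> nat"
  assumes "group \<Gamma>" and am: "amenable \<Gamma>" and sof: "sofic_approximation \<Gamma> d \<sigma>"
    and act: "group_action \<Gamma> (topspace X) act"
    and \<rho>: "\<And>x. x \<in> topspace X \<Longrightarrow> \<rho> x x = 0"
      "\<And>x y. x \<in> topspace X \<Longrightarrow> y \<in> topspace X \<Longrightarrow> 0 \<le> \<rho> x y \<and> \<rho> x y \<le> D"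
    and x0: "x0 \<in> topspace X"
    and K: "finite K" "K \<subseteq> carrier \<Gamma>" and \<delta>: "0 < \<delta>"
  shows "\<forall>\<^sub>F i in sequentially. Map_approx X act \<rho> K \<delta> (d i) (\<sigma> i) \<noteq> {}"
proof -
  interpret group \<Gamma> by fact
  \<comment> \<open>This gives \<open>D\<^sup>2 * \<theta> < \<delta>\<^sup>2\<close> with strict
    inequality, also when \<open>D = 0\<close>.\<close>
  define \<theta> where "\<theta> = \<delta>\<^sup>2 / (D\<^sup>2 + 1)"
  have D: "0 < D\<^sup>2 + 1" by (simp add: add_nonneg_pos)
  then have \<theta>: "0 < \<theta>" using \<delta> by (simp add: \<theta>_def)
  have "D\<^sup>2 * \<theta> < (D\<^sup>2 + 1) * \<theta>" using \<theta> by simp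
  then have D\<theta>: "D\<^sup>2 * \<theta> < \<delta>\<^sup>2" using D by (simp add: \<theta>_def)
  have d: "d i \<ge> 1" and perm: "g \<in> carrier \<Gamma> \<Longrightarrow> \<sigma> i g permutes {1..d i}" for i g
    using sof by (auto simp: sofic_approximation_def)
  have closed: "act g x \<in> topspace X" if "g \<in> carrier \<Gamma>" "x \<in> topspace X" for g x
    using group_action.element_image[OF act that] by simp
  from eventually_almost_equivariant_selection[OF assms(1) am sof K \<theta>]
  show ?thesis
  proof eventually_elim
    case (elim i)
    then obtain a :: "nat \<Rightarrow> 'g" where a: "\<And>j. a j \<in> carrier \<Gamma>"
      and few: "\<And>g. g \<in> K \<Longrightarrow>
        real (card {j\<in>{1..d i}. a (\<sigma> i g j) \<otimes> g \<noteq> a j}) \<le> \<theta> * real (d i)" by blast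
    define n where "n = d i"
    have n: "0 < n" using d[of i] by (simp add: n_def)
    define \<phi> where "\<phi> = restrict (\<lambda>j. act (inv (a j)) x0) {1..n}"
    have \<phi>: "\<phi> j \<in> topspace X" if "j \<in> {1..n}" for j
      using that closed x0 a by (simp add: \<phi>_def)
    have "lq_dist \<rho> 2 {1..n} (\<phi> \<circ> \<sigma> i g) (\<lambda>j. act g (\<phi> j)) < \<delta>" if g: "g \<in> K" for g
    proof -
      have gc: "g \<in> carrier \<Gamma>" using g K by blast
      have \<sigma>n: "\<sigma> i g j \<in> {1..n}" if "j \<in> {1..n}" for j
        using permutes_in_image[OF perm[OF gc]] that unfolding n_def by blast
      define r where "r j = \<rho> (\<phi> (\<sigma> i g j)) (act g (\<phi> j))" for j
      define Z where "Z = {j\<in>{1..n}. a (\<sigma> i g j) \<otimes> g \<noteq> a j}"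
      have r: "0 \<le> r j" "r j \<le> D" if "j \<in> {1..n}" for j
        using \<rho>(2) \<phi> \<sigma>n closed gc that by (auto simp: r_def)
      have r0: "r j = 0" if j: "j \<in> {1..n}" "j \<notin> Z" for j
      proof -
        have aj: "a j = a (\<sigma> i g j) \<otimes> g" using j by (simp add: Z_def)
        have "inv (a (\<sigma> i g j)) = g \<otimes> inv (a j)"
          unfolding aj using a gc by (simp add: inv_mult_group flip: m_assoc)
        then have "\<phi> (\<sigma> i g j) = act g (\<phi> j)"
          using j \<sigma>n[OF j(1)] group_action.composition_rule[OF act x0 gc, of "inv (a j)"] a
          by (simp add: \<phi>_def)
        then show ?thesis using \<rho>(1) closed[OF gc \<phi>[OF j(1)]] by (simp add: r_def)
      qed
      have "(\<Sum>j\<in>{1..n}. (r j)\<^sup>2) = (\<Sum>j\<in>Z. (r j)\<^sup>2)"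
        by (rule sum.mono_neutral_right) (auto simp: Z_def r0[unfolded Z_def])
      also have "\<dots> \<le> real (card Z) * D\<^sup>2"
        using r by (intro sum_bounded_above power_mono) (auto simp: Z_def)
      also have "\<dots> \<le> (\<theta> * real n) * D\<^sup>2"
        using few[OF g] by (intro mult_right_mono) (auto simp: Z_def n_def)
      also have "\<dots> = real n * (D\<^sup>2 * \<theta>)" by simp
      also have "\<dots> < real n * \<delta>\<^sup>2" using D\<theta> n by simp
      finally have "(\<Sum>j\<in>{1..n}. (r j)\<^sup>2) / real n < \<delta>\<^sup>2" using n by (simp add: field_simps)
      then have lt: "sqrt ((\<Sum>j\<in>{1..n}. (r j)\<^sup>2) / real n) < \<delta>"
        using \<delta> by (intro real_less_lsqrt) auto
      have "(\<Sum>j\<in>{1..n}. r j powr 2) = (\<Sum>j\<in>{1..n}. (r j)\<^sup>2)"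
        using r(1) by (intro sum.cong refl powr_numeral)
      then have "lq_dist \<rho> 2 {1..n} (\<phi> \<circ> \<sigma> i g) (\<lambda>j. act g (\<phi> j))
          = sqrt ((\<Sum>j\<in>{1..n}. (r j)\<^sup>2) / real n)"
        using n by (simp add: lq_dist_def r_def powr_half_sqrt sum_nonneg)
      then show ?thesis using lt by simp
    qed
    then have "\<phi> \<in> Map_approx X act \<rho> K \<delta> n (\<sigma> i)"
      using \<phi> by (auto simp: Map_approx_def \<phi>_def)
    then show ?case by (auto simp: n_def)
  qed
qed

section \<open>Existence of independence sets\<close>

lemma continuous_pseudometric_bounded:
  assumes "compact_space X" "continuous_pseudometric X \<rho>"
  obtains D where "\<And>x y. x \<in> topspace X \<Longrightarrow> y \<in> topspace X \<Longrightarrow> \<rho> x y \<le> D"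
proof -
  have "compactin (prod_topology X X) (topspace X \<times> topspace X)"
    using assms(1) by (simp add: compactin_Times flip: compact_space_def)
  then have "compactin euclideanreal ((\<lambda>(x, y). \<rho> x y) ` (topspace X \<times> topspace X))"
    by (rule image_compactin) (use assms(2) in \<open>simp add: continuous_pseudometric_def\<close>)
  then have "bounded ((\<lambda>(x, y). \<rho> x y) ` (topspace X \<times> topspace X))"
    by (simp add: compact_imp_bounded)
  then obtain D where D: "\<And>r. r \<in> (\<lambda>(x, y). \<rho> x y) ` (topspace X \<times> topspace X) \<Longrightarrow> \<bar>r\<bar> \<le> D"
    unfolding bounded_iff real_norm_def by blast
  have "\<rho> x y \<le> D" if "x \<in> topspace X" "y \<in> topspace X" for x y
    using D[of "\<rho> x y"] that by fastforce
  then show ?thesis using that by blast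
qed

text \<open>The value of \<open>indep_density_at\<close> does not distinguish between \<open>{}\<close> being the largest
  independence set and there being none, but independence sequences do; hence the need for
  existence at all large \<open>i\<close>.\<close>

lemma eventually_independence_set_exists:
  assumes "group \<Gamma>" "amenable \<Gamma>" "sofic_approximation \<Gamma> d \<sigma>"
    and "compact_space X" "group_action \<Gamma> (topspace X) act" "continuous_pseudometric X \<rho>"
    and x: "x \<in> {1..k} \<rightarrow>\<^sub>E topspace X" and "0 < \<epsilon>"
    and "finite F" "F \<subseteq> carrier \<Gamma>" "0 < \<delta>"
  shows "\<forall>\<^sub>F i in sequentially. \<exists>J. independence_set X act \<rho> q k x F \<delta> (d i) (\<sigma> i) \<epsilon> K J"
proof (cases "k = 0")
  case True
  \<comment> \<open>With no colours the space may be empty, and \<open>{}\<close> may fail: its one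
    colouring still asks for an approximately equivariant map. The nonempty set
    \<open>{1..d i}\<close> has no colouring at all.\<close>
  have "independence_set X act \<rho> q k x F \<delta> (d i) (\<sigma> i) \<epsilon> K {1..d i}" for i
  proof -
    have "1 \<in> {1..d i}" using assms(3) by (simp add: sofic_approximation_def)
    then have "{1..d i} \<rightarrow>\<^sub>E {1..k} = {}" using True by (auto simp: PiE_eq_empty_iff)
    then show ?thesis by (simp add: independence_set_def)
  qed
  then show ?thesis by (intro always_eventually) blast
next
  case False
  then have x1: "x 1 \<in> topspace X" using x by auto
  obtain D where D: "\<And>x y. x \<in> topspace X \<Longrightarrow> y \<in> topspace X \<Longrightarrow> \<rho> x y \<le> D"
    using continuous_pseudometric_bounded assms by blast
  have "\<forall>\<^sub>F i in sequentially. Map_approx X act \<rho> F \<delta> (d i) (\<sigma> i) \<noteq> {}"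
    by (rule eventually_Map_approx_nonempty[where D = D and ?x0.0 = "x 1"])
      (use assms x1 D in \<open>auto simp: continuous_pseudometric_def\<close>)
  then show ?thesis
  proof eventually_elim
    case (elim i)
    \<comment> \<open>Over the empty set \<open>lq_dist\<close> is 0, so any approximately
      equivariant map shadows the empty colouring.\<close>
    then have "independence_set X act \<rho> q k x F \<delta> (d i) (\<sigma> i) \<epsilon> K {}"
      using \<open>0 < \<epsilon>\<close> by (auto simp: independence_set_def shadows_def lq_dist_def)
    then show ?case ..
  qed
qed

section \<open>Comparison of the two independence densities\<close>

lemma
  shows finite_independence_sets: "finite {J. independence_set X act \<rho> q k x F \<delta> n s \<epsilon> K J}"
    and indep_density_at_upper: "independence_set X act \<rho> q k x F \<delta> n s \<epsilon> K J \<Longrightarrow>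
      unif n J \<le> indep_density_at X act \<rho> q k x F \<delta> n s \<epsilon> K"
    and indep_density_at_attained: "\<exists>J. independence_set X act \<rho> q k x F \<delta> n s \<epsilon> K J \<Longrightarrow>
      \<exists>J. independence_set X act \<rho> q k x F \<delta> n s \<epsilon> K J \<and>
        unif n J = indep_density_at X act \<rho> q k x F \<delta> n s \<epsilon> K"
proof -
  let ?I = "{J. independence_set X act \<rho> q k x F \<delta> n s \<epsilon> K J}"
  show fin: "finite ?I"
    by (rule finite_subset[of _ "Pow {1..n}"]) (auto simp: independence_set_def)
  show "unif n J \<le> indep_density_at X act \<rho> q k x F \<delta> n s \<epsilon> K"
    if "independence_set X act \<rho> q k x F \<delta> n s \<epsilon> K J"
    using that fin unfolding indep_density_at_def by (intro Max_ge) auto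
  show "\<exists>J. independence_set X act \<rho> q k x F \<delta> n s \<epsilon> K J \<and>
        unif n J = indep_density_at X act \<rho> q k x F \<delta> n s \<epsilon> K"
    if "\<exists>J. independence_set X act \<rho> q k x F \<delta> n s \<epsilon> K J"
  proof -
    have ne: "unif n ` ?I \<noteq> {}" using that by blast
    \<comment> \<open>Densities are nonnegative, so once an independence set exists the inserted 0
      does not change the maximum.\<close>
    have "0 \<le> Max (unif n ` ?I)" using ne fin unif_nonneg by (subst Max_ge_iff) auto
    then have "indep_density_at X act \<rho> q k x F \<delta> n s \<epsilon> K = Max (unif n ` ?I)"
      unfolding indep_density_at_def using ne fin by (simp add: Max_insert)
    also have "\<dots> \<in> unif n ` ?I" using ne fin by (intro Max_in) auto
    finally show ?thesis by auto
  qed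
qed

text \<open>The densities already agree for each fixed \<open>F\<close> and \<delta>, before the
  infima are taken.\<close>

lemma Lambda_indep_density_eq_indep_density:
  assumes "group \<Gamma>" and am: "amenable \<Gamma>" and sof: "sofic_approximation \<Gamma> d \<sigma>"
    and X: "compact_space X" "group_action \<Gamma> (topspace X) act" "continuous_pseudometric X \<rho>"
    and x: "x \<in> {1..k} \<rightarrow>\<^sub>E topspace X" and "0 < \<epsilon>"
  shows "Lambda_indep_density \<Gamma> X act \<rho> d \<sigma> q k x \<epsilon> K = indep_density \<Gamma> X act \<rho> d \<sigma> q k x \<epsilon> K"
proof -
  let ?E = "{E. finite E \<and> E \<subseteq> group_algebra \<Gamma>}"
  note Lambda_at = amenable_eventually_Lambda_at[OF assms(1) am sof]
  have eq: "(SUP E\<in>?E. SUP \<eta>\<in>{0<..}. Lambda_indep_density_at \<Gamma> X act \<rho> d \<sigma> q k x F \<delta> E \<eta> \<epsilon> K)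
      = limsup (\<lambda>i. ereal (indep_density_at X act \<rho> q k x F \<delta> (d i) (\<sigma> i) \<epsilon> K))"
    (is "?l = limsup (\<lambda>i. ereal (?I i))")
    if F: "finite F" "F \<subseteq> carrier \<Gamma>" and \<delta>: "0 < \<delta>" for F \<delta>
  proof (rule antisym)
    have I0: "0 \<le> ?I i" for i
      unfolding indep_density_at_def by (intro Max_ge finite.insertI finite_imageI finite_independence_sets) simp
    have "Lambda_indep_density_at \<Gamma> X act \<rho> d \<sigma> q k x F \<delta> E \<eta> \<epsilon> K \<le> limsup (\<lambda>i. ereal (?I i))"
      if E: "finite E" "E \<subseteq> group_algebra \<Gamma>" "0 < \<eta>" for E \<eta>
      unfolding Lambda_indep_density_at_def
    proof (rule Sup_least, elim insertE)
      show "u \<le> limsup (\<lambda>i. ereal (?I i))" if "u = 0" for u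
        using that I0 by (auto intro!: le_Limsup)
      fix u assume "u \<in> {limsup (\<lambda>i. ereal (unif (d i) (J i))) | J.
        Lambda_independence_sequence \<Gamma> X act \<rho> d \<sigma> q k x F \<delta> E \<eta> \<epsilon> K J}"
      then obtain J where u: "u = limsup (\<lambda>i. ereal (unif (d i) (J i)))"
        and J: "\<And>i. J i \<subseteq> {1..d i}"
        and sh: "\<forall>\<^sub>F i in sequentially. \<forall>c\<in>J i \<rightarrow>\<^sub>E {1..k}.
          (\<forall>l\<in>{1..k}. {j\<in>J i. c j = l} \<in> Lambda_at \<Gamma> E \<eta> (d i) (\<sigma> i)) \<longrightarrow>
          shadows X act \<rho> q x F \<delta> (d i) (\<sigma> i) \<epsilon> K (J i) c"
        unfolding Lambda_independence_sequence_def Lambda_seq_def by blast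
      from sh Lambda_at[OF E]
      have "\<forall>\<^sub>F i in sequentially. ereal (unif (d i) (J i)) \<le> ereal (?I i)"
      proof eventually_elim
        case (elim i)
        \<comment> \<open>Every colour class satisfies the weak containment condition at this
          \<open>i\<close>, so the restricted shadowing property covers all colourings.\<close>
        have Lam: "{j\<in>J i. c j = l} \<in> Lambda_at \<Gamma> E \<eta> (d i) (\<sigma> i)" for c l
        proof -
          have "{j\<in>J i. c j = l} \<subseteq> {1..d i}" using J[of i] by blast
          with elim(2) show ?thesis by simp
        qed
        have "independence_set X act \<rho> q k x F \<delta> (d i) (\<sigma> i) \<epsilon> K (J i)"
          unfolding independence_set_def
        proof (intro conjI ballI J)
          fix c assume "c \<in> J i \<rightarrow>\<^sub>E {1..k}"
          from bspec[OF elim(1) this] show "shadows X act \<rho> q x F \<delta> (d i) (\<sigma> i) \<epsilon> K (J i) c"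
            by (rule mp) (intro ballI Lam)
        qed
        then show ?case by (simp add: indep_density_at_upper)
      qed
      then show "u \<le> limsup (\<lambda>i. ereal (?I i))" unfolding u by (rule Limsup_mono)
    qed
    then show "?l \<le> limsup (\<lambda>i. ereal (?I i))" by (intro SUP_least) auto
  next
    let ?ind = "\<lambda>i. independence_set X act \<rho> q k x F \<delta> (d i) (\<sigma> i) \<epsilon> K"
    \<comment> \<open>An independence set of maximal density where one exists. The default
      \<open>{}\<close> keeps \<open>J i\<close> inside \<open>{1..d i}\<close> and occurs for only
      finitely many \<open>i\<close> by \<open>ex\<close>.\<close>
    define J where "J i = (if \<exists>J. ?ind i J then SOME J. ?ind i J \<and> unif (d i) J = ?I i else {})" for i
    have J: "?ind i (J i)" "unif (d i) (J i) = ?I i" if "\<exists>J. ?ind i J" for i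
      using someI_ex[OF indep_density_at_attained[OF that]] that by (auto simp: J_def)
    have Jsub: "J i \<subseteq> {1..d i}" for i
      using J(1)[of i] by (cases "\<exists>J. ?ind i J") (auto simp: independence_set_def J_def)
    have ex: "\<forall>\<^sub>F i in sequentially. \<exists>J. ?ind i J"
      by (rule eventually_independence_set_exists[OF assms(1) am sof X x \<open>0 < \<epsilon>\<close> F \<delta>])
    have "J \<in> Lambda_seq \<Gamma> d \<sigma>"
      using Jsub by (auto simp: Lambda_seq_def elim!: eventually_mono[OF Lambda_at])
    moreover have "\<forall>\<^sub>F i in sequentially. \<forall>c\<in>J i \<rightarrow>\<^sub>E {1..k}.
      shadows X act \<rho> q x F \<delta> (d i) (\<sigma> i) \<epsilon> K (J i) c"
      using ex by eventually_elim (use J(1) in \<open>auto simp: independence_set_def\<close>)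
    \<comment> \<open>Shadowing holds for every colouring, so any \<open>E\<close> and \<eta> serve;
      \<open>{}\<close> and \<open>1\<close> are the values at which the suprema are bounded
      below.\<close>
    ultimately have "Lambda_independence_sequence \<Gamma> X act \<rho> d \<sigma> q k x F \<delta> {} 1 \<epsilon> K J"
      unfolding Lambda_independence_sequence_def by (auto elim: eventually_mono)
    then have "limsup (\<lambda>i. ereal (unif (d i) (J i)))
        \<le> Lambda_indep_density_at \<Gamma> X act \<rho> d \<sigma> q k x F \<delta> {} 1 \<epsilon> K"
      unfolding Lambda_indep_density_at_def by (intro Sup_upper) blast
    also have "\<dots> \<le> ?l" by (intro SUP_upper2[of "{}"] SUP_upper2[of 1]) auto
    also have "limsup (\<lambda>i. ereal (unif (d i) (J i))) = limsup (\<lambda>i. ereal (?I i))"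
      by (rule Limsup_eq, rule eventually_mono[OF ex]) (simp only: J(2))
    finally show "limsup (\<lambda>i. ereal (?I i)) \<le> ?l" .
  qed
  show ?thesis
    unfolding Lambda_indep_density_def indep_density_def
    by (intro INF_cong refl eq) auto
qed

theorem proposition3p8:
  fixes \<Gamma> :: "('g, 'b) monoid_scheme"
    and X :: "'x topology"
    and act :: "'g \<Rightarrow> 'x \<Rightarrow> 'x"
    and \<rho> :: "'x \<Rightarrow> 'x \<Rightarrow> real"
    and d :: "nat \<Rightarrow> nat"
    and \<sigma> :: "nat \<Rightarrow> 'g \<Rightarrow> nat \<Rightarrow> nat"
    and k :: nat
    and q :: ereal
  assumes "group \<Gamma>"
    and "countable (carrier \<Gamma>)"
    and "amenable \<Gamma>"
    and "sofic_approximation \<Gamma> d \<sigma>"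
    and "compact_space X"
    and "metrizable_space X"
    and "acts_by_homeomorphisms \<Gamma> X act"
    and "continuous_pseudometric X \<rho>"
    and "dynamically_generating \<Gamma> X act \<rho>"
    and "1 \<le> q"
  shows "IE \<Gamma> X act \<rho> d \<sigma> k q = IE_Lambda \<Gamma> X act \<rho> d \<sigma> k q"
proof -
  have "group_action \<Gamma> (topspace X) act" using assms(7) by (simp add: acts_by_homeomorphisms_def)
  note eq = Lambda_indep_density_eq_indep_density[OF assms(1,3,4,5) this assms(8)]
  show ?thesis unfolding IE_def IE_Lambda_def by (auto simp: eq)
qed

end
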